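(* Let $\mathcal{G}=\mathcal{G}(\mathcal{N},\mathcal{A},u)$ be a finite game and let $X(t)$ be a solution orbit of the stochastically perturbed reinforcement learning process $$dY_{k\alpha}=v_{k\alpha}(X)\,dt+\sigma_{k\alpha}(X)\,dW_{k\alpha},\qquad X_k=Q_k(\eta_kY_k)\qquad(k\in\mathcal{N},\ \alpha\in\mathcal{A}_k).\tag{SRL}$$ If $p_k\in\mathcal{X}_k$ is dominated (even iteratively), then it becomes extinct along $X(t)$ almost surely, i.e. $\min\{X_{k\alpha}(t):\alpha\in\operatorname{supp}(p_k)\}\to0$ as $t\to\infty$ (a.s.).
   Context: Game: $\mathcal{N}=\{1,\dots,N\}$ is the finite set of players, $\mathcal{A}_k$ the finite action set of player $k$, $\mathcal{A}=\prod_k\mathcal{A}_k$, $u_k:\mathcal{A}\to\mathbb{R}$ the payoff functions, extended multilinearly to $\mathcal{X}=\prod_k\mathcal{X}_k$ with $\mathcal{X}_k=\Delta(\mathcal{A}_k)$ the simplex of mixed strategies. $v_{k\alpha}(x)=u_k(\alpha;x_{-k})$ is the payoff of $\alpha\in\mathcal{A}_k$ at $x\in\mathcal{X}$ and $v_k(x)=(v_{k\alpha}(x))_{\alpha\in\mathcal{A}_k}$. (SRL): the $W_{k\alpha}$ are independent standard Wiener processes (across players and strategies) and the diffusion coefficients $\sigma_{k\alpha}:\mathcal{X}\to\mathbb{R}$ are Lipschitz. The choice maps are $Q_k(y_k)=\arg\max_{x_k\in\mathcal{X}_k}\{\langle y_k,x_k\rangle-h_k(x_k)\}$, where the penalty function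 $h_k:\mathcal{X}_k\to\mathbb{R}$ is continuous on $\mathcal{X}_k$, smooth on the relative interior of every face of $\mathcal{X}_k$, and strongly convex: there is $K>0$ with $h_k(tx_k+(1-t)x_k')\le th_k(x_k)+(1-t)h_k(x_k')-\frac12Kt(1-t)\|x_k'-x_k\|^2$ for all $x_k,x_k'\in\mathcal{X}_k$, $t\in[0,1]$. Each learning parameter $\eta_k:[0,\infty)\to(0,\infty)$ is $C^1$-smooth, nonincreasing, with $\lim_{t\to\infty}t\eta_k(t)=+\infty$. Dominance: $p_k\in\mathcal{X}_k$ is dominated by $p_k'\in\mathcal{X}_k$ if $\langle v_k(x),p_k\rangle<\langle v_k(x),p_k'\rangle$ for all $x\in\mathcal{X}$. Iterative dominance is defined by rounds of elimination: set $\mathcal{X}_k^0=\mathcal{X}_k$ and, given $\mathcal{X}^r=\prod_k\mathcal{X}_k^r$, let $\mathcal{X}_k^{r+1}$ be the set of $p_k\in\mathcal{X}_k^r$ for which there is no $p_k'\in\mathcal{X}_k^r$ with $\langle v_k(x),p_k\rangle<\langle v_k(x),p_k'\rangle$ for all $x\in\mathcal{X}^r$; $p_k$ is iteratively dominated if $p_k\notin\mathcal{X}_k^r$ for some $r$. *)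

theory Defs
  imports "HOL-Probability.Probability"
begin

section \<open>Finite games\<close>

text \<open>
  Players are the elements of a finite type \<open>'p\<close>.  The action sets \<open>A k\<close> are nonempty subsets
  of one finite type \<open>'a\<close>, so that different players may have different numbers of actions.
  A mixed strategy of player \<open>k\<close> is a vector indexed by all of \<open>'a\<close> that vanishes off \<open>A k\<close>.
\<close>

definition mixed :: "'a::finite set \<Rightarrow> (real^'a) set" where
  "mixed B = {p. (\<forall>\<alpha>. 0 \<le> p $ \<alpha>) \<and> (\<forall>\<alpha>. \<alpha> \<notin> B \<longrightarrow> p $ \<alpha> = 0) \<and> (\<Sum>\<alpha>\<in>B. p $ \<alpha>) = 1}"

definition profiles :: "('p::finite \<Rightarrow> (real^'a::finite) set) \<Rightarrow> (real^'a^'p) set" where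
  "profiles S = {x. \<forall>k. x $ k \<in> S k}"

abbreviation mixed_profiles :: "('p::finite \<Rightarrow> 'a::finite set) \<Rightarrow> (real^'a^'p) set" where
  "mixed_profiles A \<equiv> profiles (\<lambda>k. mixed (A k))"

definition supp :: "real^'a::finite \<Rightarrow> 'a set" where
  "supp p = {\<alpha>. p $ \<alpha> \<noteq> 0}"

text \<open>A payoff function is given on pure action profiles; only its values on
  \<open>PiE UNIV A\<close>, the product of the action sets, are used.\<close>

definition mult_ext ::
  "('p::finite \<Rightarrow> 'a::finite set) \<Rightarrow> (('p \<Rightarrow> 'a) \<Rightarrow> real) \<Rightarrow> real^'a^'p \<Rightarrow> real" where
  "mult_ext A w x = (\<Sum>s\<in>PiE UNIV A. (\<Prod>j\<in>UNIV. x $ j $ s j) * w s)"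

definition replace_row :: "real^'a^'p \<Rightarrow> 'p \<Rightarrow> real^'a \<Rightarrow> real^'a^'p::finite" where
  "replace_row x k q = (\<chi> j. if j = k then q else x $ j)"

definition payoff_vec ::
  "('p::finite \<Rightarrow> 'a::finite set) \<Rightarrow> ('p \<Rightarrow> ('p \<Rightarrow> 'a) \<Rightarrow> real) \<Rightarrow> 'p \<Rightarrow> real^'a^'p \<Rightarrow> real^'a" where
  "payoff_vec A u k x =
     (\<chi> \<alpha>. if \<alpha> \<in> A k then mult_ext A (u k) (replace_row x k (axis \<alpha> 1)) else 0)"


section \<open>Dominance\<close>

definition dominates_on ::
  "('p::finite \<Rightarrow> 'a::finite set) \<Rightarrow> ('p \<Rightarrow> ('p \<Rightarrow> 'a) \<Rightarrow> real) \<Rightarrow> (real^'a^'p) set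
     \<Rightarrow> 'p \<Rightarrow> real^'a \<Rightarrow> real^'a \<Rightarrow> bool" where
  "dominates_on A u S k p' p \<longleftrightarrow>
     (\<forall>x\<in>S. payoff_vec A u k x \<bullet> p < payoff_vec A u k x \<bullet> p')"

definition dominated ::
  "('p::finite \<Rightarrow> 'a::finite set) \<Rightarrow> ('p \<Rightarrow> ('p \<Rightarrow> 'a) \<Rightarrow> real) \<Rightarrow> 'p \<Rightarrow> real^'a \<Rightarrow> bool" where
  "dominated A u k p \<longleftrightarrow>
     (\<exists>p'\<in>mixed (A k). dominates_on A u (mixed_profiles A) k p' p)"

primrec surviving ::
  "('p::finite \<Rightarrow> 'a::finite set) \<Rightarrow> ('p \<Rightarrow> ('p \<Rightarrow> 'a) \<Rightarrow> real) \<Rightarrow> nat \<Rightarrow> 'p \<Rightarrow> (real^'a) set" where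
  "surviving A u 0 = (\<lambda>k. mixed (A k))"
| "surviving A u (Suc r) =
     (\<lambda>k. {p \<in> surviving A u r k.
            \<not> (\<exists>p'\<in>surviving A u r k. dominates_on A u (profiles (surviving A u r)) k p' p)})"

definition iteratively_dominated ::
  "('p::finite \<Rightarrow> 'a::finite set) \<Rightarrow> ('p \<Rightarrow> ('p \<Rightarrow> 'a) \<Rightarrow> real) \<Rightarrow> 'p \<Rightarrow> real^'a \<Rightarrow> bool" where
  "iteratively_dominated A u k p \<longleftrightarrow> (\<exists>r. p \<notin> surviving A u r k)"


section \<open>Penalty functions, choice maps and learning parameters\<close>

primrec Ck_on :: "nat \<Rightarrow> ('v::euclidean_space \<Rightarrow> real) \<Rightarrow> 'v set \<Rightarrow> bool" where
  "Ck_on 0 f U \<longleftrightarrow> continuous_on U f"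
| "Ck_on (Suc n) f U \<longleftrightarrow> f differentiable_on U \<and>
     (\<forall>b\<in>Basis. Ck_on n (\<lambda>x. frechet_derivative f (at x) b) U)"

text \<open>Smoothness on a set that need not be open: there is a \<open>C\<^sup>\<infinity>\<close> extension to an open
  neighbourhood.  When \<open>S\<close> is relatively open in its affine hull, this is equivalent to being
  \<open>C\<^sup>\<infinity>\<close> in affine coordinates (extend along the orthogonal projection).\<close>

definition smooth_on :: "('v::euclidean_space \<Rightarrow> real) \<Rightarrow> 'v set \<Rightarrow> bool" where
  "smooth_on f S \<longleftrightarrow>
     (\<exists>U g. open U \<and> S \<subseteq> U \<and> (\<forall>n. Ck_on n g U) \<and> (\<forall>x\<in>S. g x = f x))"

definition strongly_convex_on :: "'v::real_normed_vector set \<Rightarrow> ('v \<Rightarrow> real) \<Rightarrow> bool" where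
  "strongly_convex_on S h \<longleftrightarrow>
     (\<exists>K>0. \<forall>x\<in>S. \<forall>x'\<in>S. \<forall>t\<in>{0..1}.
        h (t *\<^sub>R x + (1 - t) *\<^sub>R x')
          \<le> t * h x + (1 - t) * h x' - 1/2 * K * t * (1 - t) * (norm (x' - x))\<^sup>2)"

definition penalty :: "'a::finite set \<Rightarrow> (real^'a \<Rightarrow> real) \<Rightarrow> bool" where
  "penalty B h \<longleftrightarrow> continuous_on (mixed B) h \<and>
     (\<forall>F. F face_of mixed B \<longrightarrow> smooth_on h (rel_interior F)) \<and>
     strongly_convex_on (mixed B) h"

text \<open>For a penalty function the maximiser exists and is unique.  The coordinates of \<open>y\<close>
  outside \<open>B\<close> play no role.\<close>

definition choice_map :: "'a::finite set \<Rightarrow> (real^'a \<Rightarrow> real) \<Rightarrow> real^'a \<Rightarrow> real^'a" where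
  "choice_map B h y = arg_max_on (\<lambda>x. y \<bullet> x - h x) (mixed B)"

definition learning_parameter :: "(real \<Rightarrow> real) \<Rightarrow> bool" where
  "learning_parameter \<eta> \<longleftrightarrow>
     (\<forall>t\<ge>0. 0 < \<eta> t) \<and>
     (\<exists>\<eta>'. continuous_on {0..} \<eta>' \<and>
        (\<forall>t\<ge>0. (\<eta> has_real_derivative \<eta>' t) (at t within {0..}))) \<and>
     antimono_on {0..} \<eta> \<and>
     filterlim (\<lambda>t. t * \<eta> t) at_top at_top"


section \<open>Wiener processes and the It\^o integral\<close>

text \<open>Processes and filtrations are indexed by \<open>real\<close>, but only times \<open>t \<ge> 0\<close> matter: any
  filtration on \<open>[0,\<infinity>)\<close> extends to negative times by the trivial \<open>\<sigma>\<close>-algebra.  The filtration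
  is not required to be complete or right-continuous.\<close>

definition filtered_prob_space :: "'w measure \<Rightarrow> (real \<Rightarrow> 'w measure) \<Rightarrow> bool" where
  "filtered_prob_space M F \<longleftrightarrow>
     prob_space M \<and> filtration (space M) F \<and> (\<forall>t. subalgebra M (F t))"

definition wiener_process ::
  "'w measure \<Rightarrow> (real \<Rightarrow> 'w measure) \<Rightarrow> (real \<Rightarrow> 'w \<Rightarrow> real) \<Rightarrow> bool" where
  "wiener_process M F W \<longleftrightarrow>
     (\<forall>t\<ge>0. W t \<in> borel_measurable (F t)) \<and>
     (AE \<omega> in M. W 0 \<omega> = 0) \<and>
     (AE \<omega> in M. continuous_on {0..} (\<lambda>t. W t \<omega>)) \<and>
     (\<forall>s t. 0 \<le> s \<and> s < t \<longrightarrow>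
        distributed M lborel (\<lambda>\<omega>. W t \<omega> - W s \<omega>) (normal_density 0 (sqrt (t - s))) \<and>
        prob_space.indep_set M (sets (F s))
          (sets (vimage_algebra (space M) (\<lambda>\<omega>. W t \<omega> - W s \<omega>) borel)))"

text \<open>Independence of a family of processes means independence of the path-valued random
  variables.\<close>

definition independent_processes ::
  "'w measure \<Rightarrow> ('i \<Rightarrow> real \<Rightarrow> 'w \<Rightarrow> real) \<Rightarrow> 'i set \<Rightarrow> bool" where
  "independent_processes M W I \<longleftrightarrow>
     prob_space.indep_vars M (\<lambda>_. PiM {0..} (\<lambda>_. borel)) (\<lambda>i \<omega>. \<lambda>t\<in>{0..}. W i t \<omega>) I"

text \<open>An elementary process on \<open>[0,T)\<close> takes the value \<open>\<xi> i\<close> on \<open>[\<tau> i, \<tau> (i + 1))\<close>, where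
  \<open>0 = \<tau> 0 \<le> \<dots> \<le> \<tau> n = T\<close> and \<open>\<xi> i\<close> is bounded and known at time \<open>\<tau> i\<close>.\<close>

definition elementary ::
  "'w measure \<Rightarrow> (real \<Rightarrow> 'w measure) \<Rightarrow> real \<Rightarrow> nat \<Rightarrow> (nat \<Rightarrow> real) \<Rightarrow> (nat \<Rightarrow> 'w \<Rightarrow> real) \<Rightarrow> bool"
where
  "elementary M F T n \<tau> \<xi> \<longleftrightarrow>
     \<tau> 0 = 0 \<and> \<tau> n = T \<and> (\<forall>i<n. \<tau> i \<le> \<tau> (Suc i)) \<and>
     (\<forall>i<n. \<xi> i \<in> borel_measurable (F (\<tau> i)) \<and> (\<exists>C. \<forall>\<omega>\<in>space M. \<bar>\<xi> i \<omega>\<bar> \<le> C))"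

definition elementary_process ::
  "nat \<Rightarrow> (nat \<Rightarrow> real) \<Rightarrow> (nat \<Rightarrow> 'w \<Rightarrow> real) \<Rightarrow> real \<Rightarrow> 'w \<Rightarrow> real" where
  "elementary_process n \<tau> \<xi> t \<omega> = (\<Sum>i<n. \<xi> i \<omega> * indicator {\<tau> i..<\<tau> (Suc i)} t)"

definition elementary_integral ::
  "(real \<Rightarrow> 'w \<Rightarrow> real) \<Rightarrow> nat \<Rightarrow> (nat \<Rightarrow> real) \<Rightarrow> (nat \<Rightarrow> 'w \<Rightarrow> real) \<Rightarrow> 'w \<Rightarrow> real" where
  "elementary_integral W n \<tau> \<xi> \<omega> = (\<Sum>i<n. \<xi> i \<omega> * (W (\<tau> (Suc i)) \<omega> - W (\<tau> i) \<omega>))"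

text \<open>The integrands are the jointly measurable, adapted, square integrable processes.\<close>

definition ito_integrand ::
  "'w measure \<Rightarrow> (real \<Rightarrow> 'w measure) \<Rightarrow> real \<Rightarrow> (real \<Rightarrow> 'w \<Rightarrow> real) \<Rightarrow> bool" where
  "ito_integrand M F T f \<longleftrightarrow>
     (\<lambda>(s, \<omega>). f s \<omega>) \<in> borel_measurable (restrict_space lborel {0..T} \<Otimes>\<^sub>M M) \<and>
     (\<forall>s\<in>{0..T}. f s \<in> borel_measurable (F s)) \<and>
     (\<integral>\<^sup>+\<omega>. (\<integral>\<^sup>+s\<in>{0..T}. ennreal ((f s \<omega>)\<^sup>2) \<partial>lborel) \<partial>M) < \<infinity>"

text \<open>\<open>has_ito_integral M F W f T J\<close>: the random variable \<open>J\<close> is a version of \<open>\<integral>\<^sub>0\<^sup>T f dW\<close>,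
  i.e. the \<open>L\<^sup>2\<close>-limit of the integrals of elementary processes that converge to \<open>f\<close> in
  \<open>L\<^sup>2([0,T] \<times> M)\<close>.\<close>

definition has_ito_integral ::
  "'w measure \<Rightarrow> (real \<Rightarrow> 'w measure) \<Rightarrow> (real \<Rightarrow> 'w \<Rightarrow> real) \<Rightarrow> (real \<Rightarrow> 'w \<Rightarrow> real)
     \<Rightarrow> real \<Rightarrow> ('w \<Rightarrow> real) \<Rightarrow> bool" where
  "has_ito_integral M F W f T J \<longleftrightarrow>
     ito_integrand M F T f \<and> J \<in> borel_measurable M \<and>
     (\<exists>n \<tau> \<xi>. (\<forall>m. elementary M F T (n m) (\<tau> m) (\<xi> m)) \<and>
        (\<lambda>m. \<integral>\<^sup>+\<omega>. (\<integral>\<^sup>+s\<in>{0..T}.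
            ennreal ((f s \<omega> - elementary_process (n m) (\<tau> m) (\<xi> m) s \<omega>)\<^sup>2) \<partial>lborel) \<partial>M)
          \<longlonglongrightarrow> 0 \<and>
        (\<lambda>m. \<integral>\<^sup>+\<omega>.
            ennreal ((J \<omega> - elementary_integral W (n m) (\<tau> m) (\<xi> m) \<omega>)\<^sup>2) \<partial>M)
          \<longlonglongrightarrow> 0)"


section \<open>Stochastically perturbed reinforcement learning\<close>

text \<open>\<open>srl_solution M F W A u \<sigma> h \<eta> Y X\<close>: on the filtered probability space \<open>(M, F)\<close>, the adapted
  and almost surely continuous process \<open>Y\<close> satisfies the integral form of
  \<open>dY\<^sub>k\<^sub>\<alpha> = v\<^sub>k\<^sub>\<alpha>(X) dt + \<sigma>\<^sub>k\<^sub>\<alpha>(X) dW\<^sub>k\<^sub>\<alpha>\<close>, where \<open>X\<^sub>k = Q\<^sub>k(\<eta>\<^sub>k Y\<^sub>k)\<close>.  The initial value is any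
  \<open>F 0\<close>-measurable random variable.  Only the coordinates \<open>\<alpha> \<in> A k\<close> of \<open>Y\<close> are constrained.\<close>

definition srl_solution ::
  "'w measure \<Rightarrow> (real \<Rightarrow> 'w measure) \<Rightarrow> ('p::finite \<times> 'a::finite \<Rightarrow> real \<Rightarrow> 'w \<Rightarrow> real)
     \<Rightarrow> ('p \<Rightarrow> 'a set) \<Rightarrow> ('p \<Rightarrow> ('p \<Rightarrow> 'a) \<Rightarrow> real) \<Rightarrow> ('p \<Rightarrow> 'a \<Rightarrow> real^'a^'p \<Rightarrow> real)
     \<Rightarrow> ('p \<Rightarrow> real^'a \<Rightarrow> real) \<Rightarrow> ('p \<Rightarrow> real \<Rightarrow> real)
     \<Rightarrow> (real \<Rightarrow> 'w \<Rightarrow> real^'a^'p) \<Rightarrow> (real \<Rightarrow> 'w \<Rightarrow> real^'a^'p) \<Rightarrow> bool" where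
  "srl_solution M F W A u \<sigma> h \<eta> Y X \<longleftrightarrow>
     (\<forall>t\<ge>0. \<forall>\<omega>\<in>space M. \<forall>k. X t \<omega> $ k = choice_map (A k) (h k) (\<eta> k t *\<^sub>R (Y t \<omega> $ k))) \<and>
     (\<forall>k. \<forall>\<alpha>\<in>A k.
        (\<forall>t\<ge>0. (\<lambda>\<omega>. Y t \<omega> $ k $ \<alpha>) \<in> borel_measurable (F t)) \<and>
        (AE \<omega> in M. continuous_on {0..} (\<lambda>t. Y t \<omega> $ k $ \<alpha>)) \<and>
        (\<forall>t\<ge>0. \<exists>J. has_ito_integral M F (W (k, \<alpha>)) (\<lambda>s \<omega>. \<sigma> k \<alpha> (X s \<omega>)) t J \<and>
           (AE \<omega> in M. Y t \<omega> $ k $ \<alpha> =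
              Y 0 \<omega> $ k $ \<alpha> + integral {0..t} (\<lambda>s. payoff_vec A u k (X s \<omega>) $ \<alpha>) + J \<omega>)))"

definition extinct_along ::
  "real^'a::finite \<Rightarrow> 'p::finite \<Rightarrow> (real \<Rightarrow> real^'a^'p) \<Rightarrow> bool" where
  "extinct_along p k x \<longleftrightarrow> ((\<lambda>t. Min ((\<lambda>\<alpha>. x t $ k $ \<alpha>) ` supp p)) \<longlongrightarrow> 0) at_top"

end

(*
  Each score Y is its initial value plus the accumulated payoff plus an Ito integral with bounded
  integrand.  Kolmogorov's maximal inequality on dyadic grids together with Borel-Cantelli over the
  times 2^m shows that the Ito integrals are o(t) almost surely; from here on the argument is
  pathwise.

  Induction on the elimination rounds: once the pure strategies removed in earlier rounds are
  extinct, multilinearity keeps the payoff advantage of a dominating p' over p above some m > 0.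
  Hence <Y, p' - p> eventually exceeds m t / 2 and eta(t) <Y, p' - p> tends to infinity, whereas a
  maximiser of <eta Y, x> - h(x) charging all of supp p with weight at least e could be moved by
  e (p' - p), which bounds e eta <Y, p' - p> by the oscillation of h.
*)

theory Submission
  imports Defs
begin

section \<open>Ito integrals with bounded integrand\<close>

text \<open>\<open>has_ito_integral\<close> speaks of one fixed time. For each \<open>t\<close> it
  provides some \<open>J\<close>, determined up to a null set, with elementary approximations of its
  own. No martingale and no continuous path come with it, and \<open>J\<close> need not be
  measurable for \<open>F t\<close>, which may be incomplete. Three repairs shape the stochastic
  half. An almost surely convergent subsequence of elementary integrals gives an adapted version.
  Orthogonality of increments to the past, which is all that the maximal inequality asks of a
  martingale, is carried over from simple processes by mean-square limits. Path continuity is taken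
  from the score equation: the integral is the score minus its initial value minus the drift, and
  strong convexity makes the choice maps Lipschitz, so \<open>X\<close> and the drift are
  continuous. Null sets are then discarded at countably many times only. In the deterministic half
  only the extinction of pure strategies is fed back into the induction: a payoff is an average over
  pure profiles, those using an extinct action lose their weight, and the finitely many others have
  a least advantage.\<close>

lemma integrable_bounded_mult:
  fixes Z Y :: "'w \<Rightarrow> real"
  assumes "Z \<in> borel_measurable M" "\<exists>C. \<forall>\<omega>\<in>space M. \<bar>Z \<omega>\<bar> \<le> C" "integrable M Y"
  shows "integrable M (\<lambda>\<omega>. Z \<omega> * Y \<omega>)"
proof -
  obtain C where C: "\<And>\<omega>. \<omega> \<in> space M \<Longrightarrow> \<bar>Z \<omega>\<bar> \<le> C"
    using assms(2) by auto
  show ?thesis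
  proof (rule Bochner_Integration.integrable_bound)
    show "integrable M (\<lambda>\<omega>. C * Y \<omega>)"
      using assms(3) by simp
    show "(\<lambda>\<omega>. Z \<omega> * Y \<omega>) \<in> borel_measurable M"
      using assms by measurable
    show "AE \<omega> in M. norm (Z \<omega> * Y \<omega>) \<le> norm (C * Y \<omega>)"
    proof (rule AE_I2)
      fix \<omega> assume "\<omega> \<in> space M"
      then have "\<bar>Z \<omega>\<bar> \<le> \<bar>C\<bar>"
        using C[of \<omega>] by linarith
      then show "norm (Z \<omega> * Y \<omega>) \<le> norm (C * Y \<omega>)"
        by (simp add: abs_mult mult_right_mono)
    qed
  qed
qed

lemma bounded_mult:
  fixes f g :: "'w \<Rightarrow> real"
  assumes "\<exists>C. \<forall>\<omega>\<in>S. \<bar>f \<omega>\<bar> \<le> C" "\<exists>C. \<forall>\<omega>\<in>S. \<bar>g \<omega>\<bar> \<le> C"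
  shows "\<exists>C. \<forall>\<omega>\<in>S. \<bar>f \<omega> * g \<omega>\<bar> \<le> C"
proof -
  obtain C D where "\<And>\<omega>. \<omega> \<in> S \<Longrightarrow> \<bar>f \<omega>\<bar> \<le> C" "\<And>\<omega>. \<omega> \<in> S \<Longrightarrow> \<bar>g \<omega>\<bar> \<le> D"
    using assms by auto
  then have "\<bar>f \<omega> * g \<omega>\<bar> \<le> C * D" if "\<omega> \<in> S" for \<omega>
    using that by (force simp: abs_mult intro!: mult_mono)
  then show ?thesis by auto
qed

section \<open>Increments of a Wiener process and their covariances\<close>

locale wiener_space = prob_space M for M :: "'w measure" +
  fixes F :: "real \<Rightarrow> 'w measure" and W :: "real \<Rightarrow> 'w \<Rightarrow> real"
  assumes filtered: "filtered_prob_space M F"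
    and wiener: "wiener_process M F W"
begin

lemma space_F: "space (F t) = space M"
  using filtered by (simp add: filtered_prob_space_def subalgebra_def)

lemma measurable_F_mono:
  assumes "f \<in> borel_measurable (F s)" "s \<le> t"
  shows "f \<in> borel_measurable (F t)"
proof -
  have "sets (F s) \<subseteq> sets (F t)"
    using filtered assms(2) filtration.sets_F_mono[of "space M" F s t]
    by (auto simp: filtered_prob_space_def)
  then show ?thesis
    using assms(1) measurable_mono[of borel borel "F s" "F t"] by (auto simp: space_F)
qed

lemma measurable_F_M:
  assumes "f \<in> borel_measurable (F s)"
  shows "f \<in> borel_measurable M"
  using filtered assms unfolding filtered_prob_space_def
  by (auto intro: measurable_from_subalg)

lemma W_measurable_F: "0 \<le> s \<Longrightarrow> s \<le> t \<Longrightarrow> W s \<in> borel_measurable (F t)"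
  using wiener measurable_F_mono[of "W s" s t] by (auto simp: wiener_process_def)

lemma W_measurable: "0 \<le> t \<Longrightarrow> W t \<in> borel_measurable M"
  using W_measurable_F measurable_F_M by blast

text \<open>\<open>wiener_process\<close> asserts independence of sigma-algebras. As
  \<open>Z\<close> generates a sub-sigma-algebra of \<open>F s\<close>, this passes to the pair of
  random variables, for which the product rules for expectations are available.\<close>

lemma indep_increment:
  assumes "0 \<le> s" "s < t" "Z \<in> borel_measurable (F s)"
  shows "indep_var borel Z borel (\<lambda>\<omega>. W t \<omega> - W s \<omega>)"
  unfolding indep_var_eq
proof (intro conjI)
  let ?D = "\<lambda>\<omega>. W t \<omega> - W s \<omega>"
  show "random_variable borel Z"
    using assms measurable_F_M by blast
  show D: "random_variable borel ?D"
    using assms W_measurable[of s] W_measurable[of t] by simp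
  have ind: "indep_set (sets (F s)) (sets (vimage_algebra (space M) ?D borel))"
    using wiener assms by (auto simp: wiener_process_def)
  have "sigma_sets (space M) {Z -` B \<inter> space M |B. B \<in> sets borel} \<subseteq> sets (F s)"
    unfolding space_F[of s, symmetric]
    by (rule sets.sigma_sets_subset) (use assms in \<open>auto intro: measurable_sets\<close>)
  moreover have "sigma_sets (space M) {?D -` B \<inter> space M |B. B \<in> sets borel}
      = sets (vimage_algebra (space M) ?D borel)"
    by (simp add: sets_vimage_algebra)
  ultimately show "indep_set (sigma_sets (space M) {Z -` B \<inter> space M |B. B \<in> sets borel})
      (sigma_sets (space M) {?D -` B \<inter> space M |B. B \<in> sets borel})"
    using ind unfolding indep_sets2_eq by auto
qed

lemma increment_moments:
  assumes "0 \<le> s" "s \<le> t"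
  shows "integrable M (\<lambda>\<omega>. W t \<omega> - W s \<omega>)" "expectation (\<lambda>\<omega>. W t \<omega> - W s \<omega>) = 0"
    "integrable M (\<lambda>\<omega>. (W t \<omega> - W s \<omega>)\<^sup>2)" "expectation (\<lambda>\<omega>. (W t \<omega> - W s \<omega>)\<^sup>2) = t - s"
proof -
  let ?D = "\<lambda>\<omega>. W t \<omega> - W s \<omega>"
  have "integrable M ?D \<and> expectation ?D = 0 \<and> integrable M (\<lambda>\<omega>. (?D \<omega>)\<^sup>2) \<and> expectation (\<lambda>\<omega>. (?D \<omega>)\<^sup>2) = t - s"
  \<comment> \<open>A normal density is given only for \<open>s < t\<close>; for
    \<open>s = t\<close> the increment is identically 0.\<close>
  proof (cases "s = t")
    case False
    with assms have st: "s < t" by simp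
    then have pos: "0 < sqrt (t - s)" by simp
    have D: "distributed M lborel ?D (normal_density 0 (sqrt (t - s)))"
      using wiener assms st by (auto simp: wiener_process_def)
    have e: "expectation ?D = 0"
      by (rule normal_distributed_expectation[OF pos D])
    have v: "expectation (\<lambda>\<omega>. (?D \<omega>)\<^sup>2) = t - s"
      using normal_distributed_variance[OF pos D] e st by simp
    \<comment> \<open>The Bochner integral of a non-integrable function is 0 by convention, whereas
      the value found here is \<open>t - s > 0\<close>. So the variance formula itself yields
      integrability.\<close>
    have i2: "integrable M (\<lambda>\<omega>. (?D \<omega>)\<^sup>2)"
      by (rule ccontr) (use v st not_integrable_integral_eq in fastforce)
    moreover have "?D \<in> borel_measurable M"
      using W_measurable assms by simp
    ultimately have "integrable M ?D"
      using square_integrable_imp_integrable by blast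
    then show ?thesis using e v i2 by simp
  qed simp
  then show "integrable M ?D" "expectation ?D = 0"
    "integrable M (\<lambda>\<omega>. (?D \<omega>)\<^sup>2)" "expectation (\<lambda>\<omega>. (?D \<omega>)\<^sup>2) = t - s"
    by auto
qed

text \<open>Products of independent integrable variables are integrable, so \<open>Z\<close> need
  not be bounded. This matters below, where \<open>Z\<close> contains an earlier increment or is
  merely square integrable.\<close>

lemma integral_mult_increment:
  assumes st: "0 \<le> s" "s \<le> t" and Z: "Z \<in> borel_measurable (F s)" "integrable M Z"
  shows "integrable M (\<lambda>\<omega>. Z \<omega> * (W t \<omega> - W s \<omega>))"
    "expectation (\<lambda>\<omega>. Z \<omega> * (W t \<omega> - W s \<omega>)) = 0"
    "integrable M (\<lambda>\<omega>. Z \<omega> * (W t \<omega> - W s \<omega>)\<^sup>2)"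
    "expectation (\<lambda>\<omega>. Z \<omega> * (W t \<omega> - W s \<omega>)\<^sup>2) = expectation Z * (t - s)"
proof -
  let ?D = "\<lambda>\<omega>. W t \<omega> - W s \<omega>"
  have "integrable M (\<lambda>\<omega>. Z \<omega> * ?D \<omega>) \<and> expectation (\<lambda>\<omega>. Z \<omega> * ?D \<omega>) = 0 \<and>
    integrable M (\<lambda>\<omega>. Z \<omega> * (?D \<omega>)\<^sup>2) \<and> expectation (\<lambda>\<omega>. Z \<omega> * (?D \<omega>)\<^sup>2) = expectation Z * (t - s)"
  proof (cases "s = t")
    case False
    with st have "s < t" by simp
    then have ind: "indep_var borel Z borel ?D"
      using indep_increment st Z by simp
    then have ind2: "indep_var borel Z borel (\<lambda>\<omega>. (?D \<omega>)\<^sup>2)"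
      using indep_var_compose[OF ind, of "\<lambda>x. x" borel "\<lambda>x. x\<^sup>2" borel] by (simp add: o_def)
    show ?thesis
      using indep_var_lebesgue_integral[OF ind] indep_var_lebesgue_integral[OF ind2]
        indep_var_integrable[OF ind] indep_var_integrable[OF ind2] Z increment_moments[OF st]
      by simp
  qed simp
  then show "integrable M (\<lambda>\<omega>. Z \<omega> * ?D \<omega>)" "expectation (\<lambda>\<omega>. Z \<omega> * ?D \<omega>) = 0"
    "integrable M (\<lambda>\<omega>. Z \<omega> * (?D \<omega>)\<^sup>2)" "expectation (\<lambda>\<omega>. Z \<omega> * (?D \<omega>)\<^sup>2) = expectation Z * (t - s)"
    by auto
qed

lemma integrable_bounded:
  assumes "Z \<in> borel_measurable M" "\<exists>C. \<forall>\<omega>\<in>space M. \<bar>Z \<omega>\<bar> \<le> C"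
  shows "integrable M (Z :: 'w \<Rightarrow> real)"
  using integrable_bounded_mult[OF assms, of "\<lambda>_. 1"] by simp

text \<open>The overlap is computed by splitting the increments at the endpoints of the common part
  of \<open>[a, b)\<close> and \<open>[c, d)\<close>; only the square of the increment over that part survives.\<close>

lemma increments_covariance_ordered:
  assumes ord: "0 \<le> a" "a \<le> c" "a \<le> b" "c \<le> d"
    and Z: "Z \<in> borel_measurable (F c)" "\<exists>C. \<forall>\<omega>\<in>space M. \<bar>Z \<omega>\<bar> \<le> C"
  shows "has_bochner_integral M (\<lambda>\<omega>. Z \<omega> * ((W b \<omega> - W a \<omega>) * (W d \<omega> - W c \<omega>)))
    (expectation Z * max 0 (min b d - max a c))"
proof -
  \<comment> \<open>The earlier increment is absorbed into the multiplier: \<open>Z\<close> times it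
    is integrable and known at \<open>s'\<close>, and a later increment has mean 0 against anything
    of that kind.\<close>
  have cross: "has_bochner_integral M (\<lambda>\<omega>. Z \<omega> * (W s \<omega> - W r \<omega>) * (W t \<omega> - W s' \<omega>)) 0"
    if "0 \<le> r" "r \<le> s" "s \<le> s'" "s' \<le> t" "c \<le> s'" for r s s' t
  proof -
    have "(\<lambda>\<omega>. Z \<omega> * (W s \<omega> - W r \<omega>)) \<in> borel_measurable (F s')"
      using that Z(1) by (intro borel_measurable_times borel_measurable_diff W_measurable_F)
        (auto intro: measurable_F_mono)
    moreover have "integrable M (\<lambda>\<omega>. Z \<omega> * (W s \<omega> - W r \<omega>))"
      using that Z measurable_F_M[OF Z(1)] by (intro integrable_bounded_mult increment_moments) auto
    ultimately show ?thesis
      using integral_mult_increment[of s' t "\<lambda>\<omega>. Z \<omega> * (W s \<omega> - W r \<omega>)"] that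
      by (auto simp: has_bochner_integral_iff)
  qed
  have intZ: "integrable M Z"
    by (rule integrable_bounded[OF measurable_F_M[OF Z(1)] Z(2)])
  have sq: "has_bochner_integral M (\<lambda>\<omega>. Z \<omega> * (W t \<omega> - W c \<omega>)\<^sup>2) (expectation Z * (t - c))" if "c \<le> t" for t
    unfolding has_bochner_integral_iff
    using integral_mult_increment(3,4)[OF _ that Z(1) intZ] ord by simp
  consider "b \<le> c" | "c \<le> b" "b \<le> d" | "c \<le> b" "d \<le> b" by linarith
  then show ?thesis
  proof cases
    case 1
    have "max 0 (min b d - max a c) = 0"
      using 1 ord by simp
    moreover have "has_bochner_integral M (\<lambda>\<omega>. Z \<omega> * (W b \<omega> - W a \<omega>) * (W d \<omega> - W c \<omega>)) 0"
      using 1 ord by (intro cross) auto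
    ultimately show ?thesis
      by (simp only: mult.assoc mult_zero_right)
  next
    case 2
    have "has_bochner_integral M (\<lambda>\<omega>. Z \<omega> * (W c \<omega> - W a \<omega>) * (W d \<omega> - W c \<omega>)
        + Z \<omega> * (W b \<omega> - W c \<omega>)\<^sup>2 + Z \<omega> * (W b \<omega> - W c \<omega>) * (W d \<omega> - W b \<omega>))
        (0 + expectation Z * (b - c) + 0)"
      by (rule has_bochner_integral_add[OF has_bochner_integral_add[OF cross sq] cross])
        (use 2 ord in auto)
    moreover have "(\<lambda>\<omega>. Z \<omega> * (W c \<omega> - W a \<omega>) * (W d \<omega> - W c \<omega>)
        + Z \<omega> * (W b \<omega> - W c \<omega>)\<^sup>2 + Z \<omega> * (W b \<omega> - W c \<omega>) * (W d \<omega> - W b \<omega>))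
        = (\<lambda>\<omega>. Z \<omega> * ((W b \<omega> - W a \<omega>) * (W d \<omega> - W c \<omega>)))"
      by (simp add: fun_eq_iff power2_eq_square) (simp add: algebra_simps)
    moreover have "max 0 (min b d - max a c) = b - c"
      using 2 ord by simp
    ultimately show ?thesis by simp
  next
    case 3
    have "has_bochner_integral M (\<lambda>\<omega>. Z \<omega> * (W c \<omega> - W a \<omega>) * (W d \<omega> - W c \<omega>)
        + Z \<omega> * (W d \<omega> - W c \<omega>)\<^sup>2 + Z \<omega> * (W d \<omega> - W c \<omega>) * (W b \<omega> - W d \<omega>))
        (0 + expectation Z * (d - c) + 0)"
      by (rule has_bochner_integral_add[OF has_bochner_integral_add[OF cross sq] cross])
        (use 3 ord in auto)
    moreover have "(\<lambda>\<omega>. Z \<omega> * (W c \<omega> - W a \<omega>) * (W d \<omega> - W c \<omega>)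
        + Z \<omega> * (W d \<omega> - W c \<omega>)\<^sup>2 + Z \<omega> * (W d \<omega> - W c \<omega>) * (W b \<omega> - W d \<omega>))
        = (\<lambda>\<omega>. Z \<omega> * ((W b \<omega> - W a \<omega>) * (W d \<omega> - W c \<omega>)))"
      by (simp add: fun_eq_iff power2_eq_square) (simp add: algebra_simps)
    moreover have "max 0 (min b d - max a c) = d - c"
      using 3 ord by simp
    ultimately show ?thesis by simp
  qed
qed

text \<open>Both coefficients are known at the later of the two starting times, so their product can
  serve as the multiplier of the ordered case. The factor \<open>max 0 (min b d - max a c)\<close>
  is the length of the overlap of the two intervals; this is the polarised form of the
  isometry.\<close>

lemma increments_covariance:
  assumes "0 \<le> a" "a \<le> b" "0 \<le> c" "c \<le> d"
    and xi: "\<xi> \<in> borel_measurable (F a)" "\<exists>C. \<forall>\<omega>\<in>space M. \<bar>\<xi> \<omega>\<bar> \<le> C"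
    and zeta: "\<zeta> \<in> borel_measurable (F c)" "\<exists>C. \<forall>\<omega>\<in>space M. \<bar>\<zeta> \<omega>\<bar> \<le> C"
  shows "has_bochner_integral M (\<lambda>\<omega>. (\<xi> \<omega> * (W b \<omega> - W a \<omega>)) * (\<zeta> \<omega> * (W d \<omega> - W c \<omega>)))
    (expectation (\<lambda>\<omega>. \<xi> \<omega> * \<zeta> \<omega>) * max 0 (min b d - max a c))"
proof (cases "a \<le> c")
  case True
  then have "(\<lambda>\<omega>. \<xi> \<omega> * \<zeta> \<omega>) \<in> borel_measurable (F c)"
    using assms measurable_F_mono by (intro borel_measurable_times) auto
  from increments_covariance_ordered[OF _ True _ _ this, of b d]
  show ?thesis using assms bounded_mult[OF xi(2) zeta(2)] by (simp add: ac_simps)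
next
  case False
  then have "(\<lambda>\<omega>. \<xi> \<omega> * \<zeta> \<omega>) \<in> borel_measurable (F a)"
    using assms measurable_F_mono[OF zeta(1), of a] by (intro borel_measurable_times) auto
  from increments_covariance_ordered[OF _ _ _ _ this, of c d b]
  show ?thesis using False assms bounded_mult[OF xi(2) zeta(2)]
    by (simp add: ac_simps min.commute max.commute)
qed

text \<open>Both sides expand into the same double sum of \<open>expectation (\<lambda>\<omega>.
  \<xi> i \<omega> * \<xi> j \<omega>)\<close> times overlap lengths. The intervals may overlap and
  come in any order, so that the difference of two elementary processes can be treated without a
  common refinement of their partitions.\<close>

lemma simple_isometry:
  fixes I :: "'i set"
  assumes "finite I" and ord: "\<And>i. i \<in> I \<Longrightarrow> 0 \<le> a i \<and> a i \<le> b i \<and> b i \<le> T"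
    and xi: "\<And>i. i \<in> I \<Longrightarrow> \<xi> i \<in> borel_measurable (F (a i))"
      "\<And>i. i \<in> I \<Longrightarrow> \<exists>C. \<forall>\<omega>\<in>space M. \<bar>\<xi> i \<omega>\<bar> \<le> C"
  shows "(\<integral>\<^sup>+\<omega>. ennreal ((\<Sum>i\<in>I. \<xi> i \<omega> * (W (b i) \<omega> - W (a i) \<omega>))\<^sup>2) \<partial>M)
    = (\<integral>\<^sup>+\<omega>. (\<integral>\<^sup>+s\<in>{0..T}. ennreal ((\<Sum>i\<in>I. \<xi> i \<omega> * indicator {a i..<b i} s)\<^sup>2) \<partial>lborel) \<partial>M)"
proof -
  define ov where "ov i j = max 0 (min (b i) (b j) - max (a i) (a j))" for i j
  have prod: "(\<Sum>i\<in>I. f i)\<^sup>2 = (\<Sum>i\<in>I. \<Sum>j\<in>I. f i * f j)" for f :: "'i \<Rightarrow> real"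
    by (simp add: power2_eq_square sum_product)
  have "has_bochner_integral M (\<lambda>\<omega>. (\<Sum>i\<in>I. \<xi> i \<omega> * (W (b i) \<omega> - W (a i) \<omega>))\<^sup>2)
    (\<Sum>i\<in>I. \<Sum>j\<in>I. expectation (\<lambda>\<omega>. \<xi> i \<omega> * \<xi> j \<omega>) * ov i j)"
    unfolding prod ov_def
    by (intro has_bochner_integral_sum increments_covariance) (use ord xi in auto)
  then have L: "(\<integral>\<^sup>+\<omega>. ennreal ((\<Sum>i\<in>I. \<xi> i \<omega> * (W (b i) \<omega> - W (a i) \<omega>))\<^sup>2) \<partial>M)
    = ennreal (\<Sum>i\<in>I. \<Sum>j\<in>I. expectation (\<lambda>\<omega>. \<xi> i \<omega> * \<xi> j \<omega>) * ov i j)"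
    by (subst nn_integral_eq_integral) (auto simp: has_bochner_integral_iff)
  have ind: "has_bochner_integral lborel
      (\<lambda>s. indicator {a i..<b i} s * indicator {a j..<b j} s :: real) (ov i j)" if "i \<in> I" "j \<in> I" for i j
  proof -
    have "{a i..<b i} \<inter> {a j..<b j} = {max (a i) (a j)..<min (b i) (b j)}" by auto
    moreover have "measure lborel {x..<y} = max 0 (y - x)" for x y :: real
      by (cases "x \<le> y") auto
    moreover have "emeasure lborel {x..<y} < \<infinity>" for x y :: real
      by (cases "x \<le> y") auto
    ultimately show ?thesis
      using has_bochner_integral_real_indicator[of "{a i..<b i} \<inter> {a j..<b j}" lborel]
      unfolding ov_def indicator_inter_arith by auto
  qed
  have inner: "has_bochner_integral lborel (\<lambda>s. (\<Sum>i\<in>I. \<xi> i \<omega> * indicator {a i..<b i} s)\<^sup>2)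
      (\<Sum>i\<in>I. \<Sum>j\<in>I. (\<xi> i \<omega> * \<xi> j \<omega>) * ov i j)" for \<omega>
  proof -
    have "has_bochner_integral lborel (\<lambda>s. (\<Sum>i\<in>I. \<Sum>j\<in>I. (\<xi> i \<omega> * \<xi> j \<omega>) *
      (indicator {a i..<b i} s * indicator {a j..<b j} s)))
      (\<Sum>i\<in>I. \<Sum>j\<in>I. (\<xi> i \<omega> * \<xi> j \<omega>) * ov i j)"
      by (intro has_bochner_integral_sum has_bochner_integral_mult_right ind)
    then show ?thesis unfolding prod by (simp add: ac_simps)
  qed
  have "(\<integral>\<^sup>+s\<in>{0..T}. ennreal ((\<Sum>i\<in>I. \<xi> i \<omega> * indicator {a i..<b i} s)\<^sup>2) \<partial>lborel)
    = ennreal (\<Sum>i\<in>I. \<Sum>j\<in>I. (\<xi> i \<omega> * \<xi> j \<omega>) * ov i j)" for \<omega>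
  proof -
    have "(\<Sum>i\<in>I. \<xi> i \<omega> * indicator {a i..<b i} s) = 0" if "s \<notin> {0..T}" for s
      using ord that by (intro sum.neutral) (force simp: indicator_def)
    then have "(\<integral>\<^sup>+s\<in>{0..T}. ennreal ((\<Sum>i\<in>I. \<xi> i \<omega> * indicator {a i..<b i} s)\<^sup>2) \<partial>lborel)
      = (\<integral>\<^sup>+s. ennreal ((\<Sum>i\<in>I. \<xi> i \<omega> * indicator {a i..<b i} s)\<^sup>2) \<partial>lborel)"
      by (intro nn_integral_cong) (auto simp: indicator_def)
    also have "\<dots> = ennreal (\<Sum>i\<in>I. \<Sum>j\<in>I. (\<xi> i \<omega> * \<xi> j \<omega>) * ov i j)"
      using inner[of \<omega>] by (subst nn_integral_eq_integral) (auto simp: has_bochner_integral_iff)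
    finally show ?thesis .
  qed
  moreover have "(\<integral>\<^sup>+\<omega>. ennreal (\<Sum>i\<in>I. \<Sum>j\<in>I. (\<xi> i \<omega> * \<xi> j \<omega>) * ov i j) \<partial>M)
    = ennreal (\<Sum>i\<in>I. \<Sum>j\<in>I. expectation (\<lambda>\<omega>. \<xi> i \<omega> * \<xi> j \<omega>) * ov i j)"
  proof -
    have "has_bochner_integral M (\<lambda>\<omega>. \<Sum>i\<in>I. \<Sum>j\<in>I. (\<xi> i \<omega> * \<xi> j \<omega>) * ov i j)
      (\<Sum>i\<in>I. \<Sum>j\<in>I. expectation (\<lambda>\<omega>. \<xi> i \<omega> * \<xi> j \<omega>) * ov i j)"
    proof (intro has_bochner_integral_sum has_bochner_integral_mult_left has_bochner_integral_integrable)
      fix i j assume "i \<in> I" "j \<in> I"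
      then show "integrable M (\<lambda>\<omega>. \<xi> i \<omega> * \<xi> j \<omega>)"
        by (intro integrable_bounded bounded_mult borel_measurable_times xi(2) measurable_F_M[OF xi(1)])
    qed
    \<comment> \<open>The sign is not visible in the double sum; it is read off from the sum being
      the integral of a square over time.\<close>
    moreover have "0 \<le> (\<Sum>i\<in>I. \<Sum>j\<in>I. (\<xi> i \<omega> * \<xi> j \<omega>) * ov i j)" for \<omega>
      unfolding has_bochner_integral_integral_eq[OF inner, symmetric] by simp
    ultimately show ?thesis
      by (subst nn_integral_eq_integral) (auto simp: has_bochner_integral_iff)
  qed
  ultimately show ?thesis using L by simp
qed

end

section \<open>Mean-square estimates and limits\<close>

lemma nn_integral_square_le:
  fixes f g k :: "'w \<Rightarrow> real"
  assumes [measurable]: "f \<in> borel_measurable N" "g \<in> borel_measurable N"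
    and le: "\<And>x. x \<in> space N \<Longrightarrow> \<bar>k x\<bar> \<le> \<bar>f x\<bar> + \<bar>g x\<bar>"
  shows "(\<integral>\<^sup>+x. ennreal ((k x)\<^sup>2) \<partial>N)
    \<le> 2 * (\<integral>\<^sup>+x. ennreal ((f x)\<^sup>2) \<partial>N) + 2 * (\<integral>\<^sup>+x. ennreal ((g x)\<^sup>2) \<partial>N)"
proof -
  have "(k x)\<^sup>2 \<le> 2 * (f x)\<^sup>2 + 2 * (g x)\<^sup>2" if "x \<in> space N" for x
  proof -
    have "(k x)\<^sup>2 \<le> (\<bar>f x\<bar> + \<bar>g x\<bar>)\<^sup>2"
      using power_mono[OF le[OF that], of 2] by simp
    also have "\<dots> \<le> 2 * (f x)\<^sup>2 + 2 * (g x)\<^sup>2"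
      using sum_squares_bound[of "\<bar>f x\<bar>" "\<bar>g x\<bar>"] by (simp add: power2_sum)
    finally show ?thesis .
  qed
  then have "(\<integral>\<^sup>+x. ennreal ((k x)\<^sup>2) \<partial>N) \<le> (\<integral>\<^sup>+x. ennreal (2 * (f x)\<^sup>2 + 2 * (g x)\<^sup>2) \<partial>N)"
    by (intro nn_integral_mono ennreal_leI)
  also have "\<dots> = (\<integral>\<^sup>+x. 2 * ennreal ((f x)\<^sup>2) + 2 * ennreal ((g x)\<^sup>2) \<partial>N)"
    by (simp add: ennreal_mult)
  also have "\<dots> = 2 * (\<integral>\<^sup>+x. ennreal ((f x)\<^sup>2) \<partial>N) + 2 * (\<integral>\<^sup>+x. ennreal ((g x)\<^sup>2) \<partial>N)"
    by (subst nn_integral_add) (auto simp: nn_integral_cmult)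
  finally show ?thesis .
qed

lemma integrable_square_iff:
  fixes f :: "'w \<Rightarrow> real"
  assumes "f \<in> borel_measurable N"
  shows "integrable N (\<lambda>x. (f x)\<^sup>2) \<longleftrightarrow> (\<integral>\<^sup>+x. ennreal ((f x)\<^sup>2) \<partial>N) < \<infinity>"
  using assms by (simp add: integrable_iff_bounded)

lemma integrable_mult_square_integrable:
  fixes f g :: "'w \<Rightarrow> real"
  assumes "f \<in> borel_measurable N" "g \<in> borel_measurable N"
    "integrable N (\<lambda>x. (f x)\<^sup>2)" "integrable N (\<lambda>x. (g x)\<^sup>2)"
  shows "integrable N (\<lambda>x. f x * g x)"
proof (rule Bochner_Integration.integrable_bound)
  show "integrable N (\<lambda>x. (f x)\<^sup>2 + (g x)\<^sup>2)"
    using assms by simp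
  show "(\<lambda>x. f x * g x) \<in> borel_measurable N"
    using assms by measurable
  have "\<bar>f x * g x\<bar> \<le> (f x)\<^sup>2 + (g x)\<^sup>2" for x
  proof -
    have "2 * (\<bar>f x\<bar> * \<bar>g x\<bar>) \<le> (f x)\<^sup>2 + (g x)\<^sup>2"
      using sum_squares_bound[of "\<bar>f x\<bar>" "\<bar>g x\<bar>"] by simp
    then show ?thesis
      unfolding abs_mult using mult_nonneg_nonneg[of "\<bar>f x\<bar>" "\<bar>g x\<bar>"] by linarith
  qed
  then show "AE x in N. norm (f x * g x) \<le> norm ((f x)\<^sup>2 + (g x)\<^sup>2)"
    by simp
qed

text \<open>Cauchy-Schwarz bounds the constant on the left by the norm of \<open>Z\<close> times
  that of \<open>G m\<close>, for every \<open>m\<close>. In the application \<open>G m\<close> is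
  \<open>U\<close> minus a sum that is orthogonal to \<open>Z\<close>, whence
  \<open>eq\<close>.\<close>

lemma integral_mult_eq_0_limit:
  fixes Z U :: "'w \<Rightarrow> real" and G :: "nat \<Rightarrow> 'w \<Rightarrow> real"
  assumes Z: "Z \<in> borel_measurable N" "integrable N (\<lambda>x. (Z x)\<^sup>2)"
    and G: "\<And>m. G m \<in> borel_measurable N" "\<And>m. integrable N (\<lambda>x. Z x * G m x)"
    and eq: "\<And>m. (\<integral>x. Z x * U x \<partial>N) = (\<integral>x. Z x * G m x \<partial>N)"
    and lim: "(\<lambda>m. \<integral>\<^sup>+x. ennreal ((G m x)\<^sup>2) \<partial>N) \<longlonglongrightarrow> 0"
  shows "(\<integral>x. Z x * U x \<partial>N) = 0"
proof -
  let ?e = "\<integral>x. Z x * U x \<partial>N"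
  let ?z = "\<integral>\<^sup>+x. ennreal ((Z x)\<^sup>2) \<partial>N"
  have "(ennreal \<bar>?e\<bar>)\<^sup>2 \<le> ?z * (\<integral>\<^sup>+x. ennreal ((G m x)\<^sup>2) \<partial>N)" for m
  proof -
    note [measurable] = Z(1) G(1)[of m]
    have "ennreal \<bar>?e\<bar> \<le> (\<integral>\<^sup>+x. norm (Z x * G m x) \<partial>N)"
      unfolding eq[of m] real_norm_def[symmetric] by (rule integral_norm_bound_ennreal[OF G(2)])
    then have "(ennreal \<bar>?e\<bar>)\<^sup>2 \<le> (\<integral>\<^sup>+x. ennreal \<bar>Z x\<bar> * ennreal \<bar>G m x\<bar> \<partial>N)\<^sup>2"
      by (intro power_mono) (simp_all add: abs_mult ennreal_mult)
    also have "\<dots> \<le> (\<integral>\<^sup>+x. (ennreal \<bar>Z x\<bar>)\<^sup>2 \<partial>N) * (\<integral>\<^sup>+x. (ennreal \<bar>G m x\<bar>)\<^sup>2 \<partial>N)"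
      by (rule Cauchy_Schwarz_nn_integral) measurable
    finally show ?thesis by (simp add: ennreal_power)
  qed
  moreover have "(\<lambda>m. ?z * (\<integral>\<^sup>+x. ennreal ((G m x)\<^sup>2) \<partial>N)) \<longlonglongrightarrow> ?z * 0"
    using Z lim by (intro ennreal_tendsto_cmult) (auto simp: integrable_square_iff)
  ultimately have "(ennreal \<bar>?e\<bar>)\<^sup>2 \<le> 0"
    by (intro LIMSEQ_le_const[of _ 0]) auto
  then show ?thesis by simp
qed

text \<open>The squared norm of L2([0,T] x M), kept in the iterated form that
  \<open>has_ito_integral\<close> uses.\<close>

definition square_norm :: "'w measure \<Rightarrow> real \<Rightarrow> (real \<Rightarrow> 'w \<Rightarrow> real) \<Rightarrow> ennreal" where
  "square_norm M T g = (\<integral>\<^sup>+\<omega>. (\<integral>\<^sup>+s\<in>{0..T}. ennreal ((g s \<omega>)\<^sup>2) \<partial>lborel) \<partial>M)"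

definition jointly_measurable :: "'w measure \<Rightarrow> real \<Rightarrow> (real \<Rightarrow> 'w \<Rightarrow> real) \<Rightarrow> bool" where
  "jointly_measurable M T g \<longleftrightarrow>
    (\<lambda>(s, \<omega>). g s \<omega>) \<in> borel_measurable (restrict_space lborel {0..T} \<Otimes>\<^sub>M M)"

lemma square_norm_mono:
  "s \<le> t \<Longrightarrow> square_norm M s g \<le> square_norm M t g"
  unfolding square_norm_def
  by (intro nn_integral_mono) (auto simp: indicator_def)

lemma elementary_times:
  assumes "elementary M F T n \<tau> \<xi>" "i \<le> n"
  shows "0 \<le> \<tau> i" "\<tau> i \<le> T"
proof -
  have step: "\<And>i. i < n \<Longrightarrow> \<tau> i \<le> \<tau> (Suc i)" and ends: "\<tau> 0 = 0" "\<tau> n = T"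
    using assms(1) by (auto simp: elementary_def)
  have "i \<le> n \<longrightarrow> 0 \<le> \<tau> i" for i
  proof (induction i)
    case (Suc i)
    then show ?case using step[of i] by auto
  qed (use ends in simp)
  then show "0 \<le> \<tau> i" using assms(2) by simp
  show "\<tau> i \<le> T"
    using assms(2) unfolding ends(2)[symmetric]
  proof (induction rule: inc_induct)
    case (step k)
    then show ?case using \<open>k < n\<close> assms(1) by (force simp: elementary_def)
  qed simp
qed

section \<open>Ito integrals as mean-square limits of elementary integrals\<close>

context wiener_space
begin

text \<open>Tonelli: over the product measure there is a single integral, to which
  \<open>nn_integral_square_le\<close> applies.\<close>

lemma square_norm_eq:
  assumes "jointly_measurable M T g"
  shows "square_norm M T g
    = (\<integral>\<^sup>+z. ennreal ((case z of (s, \<omega>) \<Rightarrow> g s \<omega>)\<^sup>2) \<partial>(restrict_space lborel {0..T} \<Otimes>\<^sub>M M))"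
proof -
  let ?L = "restrict_space lborel {0..T} :: real measure"
  interpret L: sigma_finite_measure ?L
    by (rule sigma_finite_measure_restrict_space) (auto intro: lborel.sigma_finite_measure_axioms)
  interpret P: pair_sigma_finite ?L M ..
  note [measurable] = assms[unfolded jointly_measurable_def]
  have "square_norm M T g = (\<integral>\<^sup>+\<omega>. (\<integral>\<^sup>+s. ennreal ((g s \<omega>)\<^sup>2) \<partial>?L) \<partial>M)"
    unfolding square_norm_def by (intro nn_integral_cong nn_integral_restrict_space[symmetric]) auto
  also have "\<dots> = (\<integral>\<^sup>+z. ennreal ((case z of (s, \<omega>) \<Rightarrow> g s \<omega>)\<^sup>2) \<partial>(?L \<Otimes>\<^sub>M M))"
    using P.nn_integral_snd[of "\<lambda>z. ennreal ((case z of (s, \<omega>) \<Rightarrow> g s \<omega>)\<^sup>2)"] by simp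
  finally show ?thesis .
qed

lemma square_norm_le:
  assumes f: "jointly_measurable M T f" and g: "jointly_measurable M T g" and k: "jointly_measurable M T k"
    and le: "\<And>s \<omega>. s \<in> {0..T} \<Longrightarrow> \<omega> \<in> space M \<Longrightarrow> \<bar>k s \<omega>\<bar> \<le> \<bar>f s \<omega>\<bar> + \<bar>g s \<omega>\<bar>"
  shows "square_norm M T k \<le> 2 * square_norm M T f + 2 * square_norm M T g"
  unfolding square_norm_eq[OF f] square_norm_eq[OF g] square_norm_eq[OF k]
  by (rule nn_integral_square_le)
    (use f g le in \<open>auto simp: jointly_measurable_def space_pair_measure space_restrict_space\<close>)

lemma jointly_measurable_simple:
  assumes "\<And>i. i \<in> I \<Longrightarrow> \<xi> i \<in> borel_measurable M"
  shows "jointly_measurable M T (\<lambda>s \<omega>. \<Sum>i\<in>I. \<xi> i \<omega> * indicator {a i..<b i} s)"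
  unfolding jointly_measurable_def split_beta
proof (intro borel_measurable_sum borel_measurable_times)
  fix i assume "i \<in> I"
  note [measurable] = assms[OF this]
  show "(\<lambda>x. \<xi> i (snd x)) \<in> borel_measurable (restrict_space lborel {0..T} \<Otimes>\<^sub>M M)"
    by measurable
  have [measurable]: "indicat_real {a i..<b i} \<in> borel_measurable (restrict_space lborel {0..T})"
    by (rule measurable_restrict_space1) simp
  show "(\<lambda>x. indicat_real {a i..<b i} (fst x)) \<in> borel_measurable (restrict_space lborel {0..T} \<Otimes>\<^sub>M M)"
    by measurable
qed

lemma jointly_measurable_elementary:
  assumes "elementary M F T n \<tau> \<xi>"
  shows "jointly_measurable M S (elementary_process n \<tau> \<xi>)"
  unfolding elementary_process_def using assms
  by (intro jointly_measurable_simple) (auto simp: elementary_def intro: measurable_F_M)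

lemma jointly_measurable_diff:
  assumes "jointly_measurable M T f" "jointly_measurable M T g"
  shows "jointly_measurable M T (\<lambda>s \<omega>. f s \<omega> - g s \<omega>)"
  using borel_measurable_diff[OF assms[unfolded jointly_measurable_def]]
  by (simp add: jointly_measurable_def split_beta)

lemma elementary_integral_measurable:
  assumes "elementary M F T n \<tau> \<xi>"
  shows "elementary_integral W n \<tau> \<xi> \<in> borel_measurable (F T)"
  unfolding elementary_integral_def
proof (intro borel_measurable_sum borel_measurable_times borel_measurable_diff W_measurable_F)
  fix i assume "i \<in> {..<n}"
  then show "0 \<le> \<tau> (Suc i)" "\<tau> (Suc i) \<le> T" "0 \<le> \<tau> i" "\<tau> i \<le> T" "\<xi> i \<in> borel_measurable (F T)"
    using elementary_times[OF assms, of i] elementary_times[OF assms, of "Suc i"] assms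
      measurable_F_mono[of "\<xi> i" "\<tau> i" T]
    by (auto simp: elementary_def)
qed

lemma elementary_isometry:
  assumes "elementary M F T n \<tau> \<xi>"
  shows "(\<integral>\<^sup>+\<omega>. ennreal ((elementary_integral W n \<tau> \<xi> \<omega>)\<^sup>2) \<partial>M)
    = square_norm M T (elementary_process n \<tau> \<xi>)"
  unfolding elementary_integral_def square_norm_def elementary_process_def
proof (rule simple_isometry)
  fix i assume "i \<in> {..<n}"
  then show "0 \<le> \<tau> i \<and> \<tau> i \<le> \<tau> (Suc i) \<and> \<tau> (Suc i) \<le> T" "\<xi> i \<in> borel_measurable (F (\<tau> i))"
    "\<exists>C. \<forall>\<omega>\<in>space M. \<bar>\<xi> i \<omega>\<bar> \<le> C"
    using elementary_times[OF assms, of i] elementary_times[OF assms, of "Suc i"] assms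
    by (auto simp: elementary_def)
qed simp

lemma ito_integral_approx:
  assumes "has_ito_integral M F W f T J"
  obtains n \<tau> \<xi> where "\<And>m. elementary M F T (n m) (\<tau> m) (\<xi> m)"
    "(\<lambda>m. square_norm M T (\<lambda>s \<omega>. f s \<omega> - elementary_process (n m) (\<tau> m) (\<xi> m) s \<omega>)) \<longlonglongrightarrow> 0"
    "(\<lambda>m. \<integral>\<^sup>+\<omega>. ennreal ((J \<omega> - elementary_integral W (n m) (\<tau> m) (\<xi> m) \<omega>)\<^sup>2) \<partial>M) \<longlonglongrightarrow> 0"
    "jointly_measurable M T f" "J \<in> borel_measurable M"
  using assms unfolding has_ito_integral_def square_norm_def jointly_measurable_def ito_integrand_def
  by blast

text \<open>\<open>J\<close> is compared with an elementary integral, the isometry is applied there,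
  and the elementary process is compared with \<open>f\<close>. Each comparison uses (a + b)^2 \<le>
  2 a^2 + 2 b^2; this accounts for the factor 4, where a sharp isometry would give 1. Only linear
  growth in \<open>T\<close> matters later.\<close>

lemma ito_integral_square_le:
  assumes J: "has_ito_integral M F W f T J" and T: "0 \<le> T"
    and bound: "\<And>s \<omega>. s \<in> {0..T} \<Longrightarrow> \<omega> \<in> space M \<Longrightarrow> \<bar>f s \<omega>\<bar> \<le> C"
  shows "(\<integral>\<^sup>+\<omega>. ennreal ((J \<omega>)\<^sup>2) \<partial>M) \<le> ennreal (4 * C\<^sup>2 * T)"
proof -
  obtain n \<tau> \<xi> where el: "\<And>m. elementary M F T (n m) (\<tau> m) (\<xi> m)"
    and l1: "(\<lambda>m. square_norm M T (\<lambda>s \<omega>. f s \<omega> - elementary_process (n m) (\<tau> m) (\<xi> m) s \<omega>)) \<longlonglongrightarrow> 0"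
      (is "?x \<longlonglongrightarrow> 0")
    and l2: "(\<lambda>m. \<integral>\<^sup>+\<omega>. ennreal ((J \<omega> - elementary_integral W (n m) (\<tau> m) (\<xi> m) \<omega>)\<^sup>2) \<partial>M) \<longlonglongrightarrow> 0"
      (is "?y \<longlonglongrightarrow> 0")
    and f: "jointly_measurable M T f" and Jm: "J \<in> borel_measurable M"
    by (rule ito_integral_approx[OF J]) (rule that; assumption)
  have "(\<integral>\<^sup>+\<omega>. ennreal ((J \<omega>)\<^sup>2) \<partial>M) \<le> 2 * ?y m + 2 * (2 * ?x m + 2 * square_norm M T f)" for m
  proof -
    have "(\<integral>\<^sup>+\<omega>. ennreal ((J \<omega>)\<^sup>2) \<partial>M)
      \<le> 2 * ?y m + 2 * (\<integral>\<^sup>+\<omega>. ennreal ((elementary_integral W (n m) (\<tau> m) (\<xi> m) \<omega>)\<^sup>2) \<partial>M)"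
      using Jm measurable_F_M[OF elementary_integral_measurable[OF el[of m]]]
      by (intro nn_integral_square_le) auto
    also have "\<dots> \<le> 2 * ?y m + 2 * (2 * ?x m + 2 * square_norm M T f)"
      unfolding elementary_isometry[OF el]
      by (intro add_left_mono mult_left_mono square_norm_le)
        (auto intro: f jointly_measurable_elementary[OF el] jointly_measurable_diff)
    finally show ?thesis .
  qed
  moreover have "(\<lambda>m. 2 * ?y m + 2 * (2 * ?x m + 2 * square_norm M T f))
      \<longlonglongrightarrow> 2 * 0 + 2 * (2 * 0 + 2 * square_norm M T f)"
    by (intro tendsto_add ennreal_tendsto_cmult tendsto_const l1 l2) auto
  ultimately have "(\<integral>\<^sup>+\<omega>. ennreal ((J \<omega>)\<^sup>2) \<partial>M) \<le> 2 * 0 + 2 * (2 * 0 + 2 * square_norm M T f)"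
    by (intro LIMSEQ_le_const) auto
  also have "\<dots> = 4 * square_norm M T f"
    by (simp add: mult.assoc[symmetric])
  also have "square_norm M T f \<le> ennreal (C\<^sup>2 * T)"
  proof -
    have "square_norm M T f \<le> (\<integral>\<^sup>+\<omega>. (\<integral>\<^sup>+s. ennreal (C\<^sup>2) * indicator {0..T} s \<partial>lborel) \<partial>M)"
      unfolding square_norm_def
    proof (intro nn_integral_mono)
      fix s \<omega> assume "\<omega> \<in> space M"
      then show "ennreal ((f s \<omega>)\<^sup>2) * indicator {0..T} s \<le> ennreal (C\<^sup>2) * indicator {0..T} s"
        using power_mono[OF bound[of s \<omega>], of 2] by (auto simp: indicator_def intro!: ennreal_leI)
    qed
    also have "\<dots> = ennreal (C\<^sup>2 * T)"
      using T by (simp add: nn_integral_cmult_indicator emeasure_space_1 ennreal_mult)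
    finally show ?thesis .
  qed
  finally show ?thesis
    by (simp add: mult_left_mono ennreal_mult' mult.assoc)
qed

text \<open>The elementary integrals are \<open>F T\<close>-measurable, but their mean-square limit
  is only determined up to a null set, which \<open>F T\<close> need not contain. A pointwise limit
  along a subsequence stays inside \<open>F T\<close>.\<close>

lemma ito_integral_adapted_version:
  assumes J: "has_ito_integral M F W f T J"
  shows "\<exists>J'. J' \<in> borel_measurable (F T) \<and> (AE \<omega> in M. J \<omega> = J' \<omega>)"
proof -
  obtain n \<tau> \<xi> where el: "\<And>m. elementary M F T (n m) (\<tau> m) (\<xi> m)"
    and "(\<lambda>m. square_norm M T (\<lambda>s \<omega>. f s \<omega> - elementary_process (n m) (\<tau> m) (\<xi> m) s \<omega>)) \<longlonglongrightarrow> 0"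
    and l2: "(\<lambda>m. \<integral>\<^sup>+\<omega>. ennreal ((J \<omega> - elementary_integral W (n m) (\<tau> m) (\<xi> m) \<omega>)\<^sup>2) \<partial>M) \<longlonglongrightarrow> 0"
    and "jointly_measurable M T f" and Jm[measurable]: "J \<in> borel_measurable M"
    by (rule ito_integral_approx[OF J]) (rule that; assumption)
  define I where "I m = elementary_integral W (n m) (\<tau> m) (\<xi> m)" for m
  have IF: "I m \<in> borel_measurable (F T)" for m
    unfolding I_def by (rule elementary_integral_measurable[OF el])
  have [measurable]: "I m \<in> borel_measurable M" for m
    by (rule measurable_F_M[OF IF])
  have "eventually (\<lambda>m. (\<integral>\<^sup>+\<omega>. ennreal ((J \<omega> - I m \<omega>)\<^sup>2) \<partial>M) < \<infinity>) sequentially"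
    using l2 unfolding I_def by (rule order_tendstoD) simp
  then obtain m0 where m0: "\<And>m. m0 \<le> m \<Longrightarrow> (\<integral>\<^sup>+\<omega>. ennreal ((J \<omega> - I m \<omega>)\<^sup>2) \<partial>M) < \<infinity>"
    by (auto simp: eventually_sequentially)
  \<comment> \<open>Finitely many of the squared distances may have infinite integral; the shift by
    \<open>m0\<close> skips them, since extraction of an almost everywhere convergent subsequence
    needs integrable terms.\<close>
  define D where "D m \<omega> = (J \<omega> - I (m + m0) \<omega>)\<^sup>2" for m \<omega>
  have intD: "integrable M (D m)" for m
    unfolding D_def using m0[of "m + m0"] by (subst integrable_square_iff) auto
  have "ennreal (\<integral>\<omega>. norm (D m \<omega>) \<partial>M) = (\<integral>\<^sup>+\<omega>. ennreal ((J \<omega> - I (m + m0) \<omega>)\<^sup>2) \<partial>M)" for m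
    using nn_integral_eq_integral[OF intD[of m]] by (simp add: D_def[abs_def])
  then have "(\<lambda>m. ennreal (\<integral>\<omega>. norm (D m \<omega>) \<partial>M)) \<longlonglongrightarrow> ennreal 0"
    using LIMSEQ_ignore_initial_segment[OF l2, of m0] by (simp add: I_def)
  then have "(\<lambda>m. \<integral>\<omega>. norm (D m \<omega>) \<partial>M) \<longlonglongrightarrow> 0"
    by (subst (asm) tendsto_ennreal_iff) auto
  from tendsto_L1_AE_subseq[OF intD this] obtain r
    where r: "AE \<omega> in M. (\<lambda>m. D (r m) \<omega>) \<longlonglongrightarrow> 0" by auto
  \<comment> \<open>\<open>lim\<close> is total: where the sequence diverges it takes a default
    value, so \<open>J'\<close> is measurable without removing a null set.\<close>
  define J' where "J' \<omega> = lim (\<lambda>m. I (r m + m0) \<omega>)" for \<omega>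
  have "J' \<in> borel_measurable (F T)"
    unfolding J'_def by (intro borel_measurable_lim_metric IF)
  moreover have "AE \<omega> in M. J \<omega> = J' \<omega>"
    using r
  proof eventually_elim
    case (elim \<omega>)
    then have "(\<lambda>m. sqrt ((J \<omega> - I (r m + m0) \<omega>)\<^sup>2)) \<longlonglongrightarrow> sqrt 0"
      unfolding D_def by (intro tendsto_real_sqrt)
    then have "(\<lambda>m. J \<omega> - I (r m + m0) \<omega>) \<longlonglongrightarrow> 0"
      by (simp add: tendsto_rabs_zero_iff)
    from tendsto_diff[OF tendsto_const[of "J \<omega>"] this]
    have "(\<lambda>m. I (r m + m0) \<omega>) \<longlonglongrightarrow> J \<omega>" by simp
    then show ?case unfolding J'_def by (simp add: limI)
  qed
  ultimately show ?thesis by blast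
qed

text \<open>The elementary approximations on \<open>[0, t]\<close> and \<open>[0, s]\<close> are unrelated.  Cutting the first at \<open>s\<close>
  splits off a sum \<open>R\<close> orthogonal to \<open>Z\<close>; what remains differs from the second by a simple process
  indexed by the disjoint union of the two partitions, which the isometry makes small.\<close>

lemma ito_integral_orthogonal_increment:
  assumes Jt: "has_ito_integral M F W f t Jt" and Js: "has_ito_integral M F W f s Js"
    and st: "0 \<le> s" "s \<le> t"
    and Z: "Z \<in> borel_measurable (F s)" "integrable M (\<lambda>\<omega>. (Z \<omega>)\<^sup>2)"
    and J2: "integrable M (\<lambda>\<omega>. (Jt \<omega>)\<^sup>2)" "integrable M (\<lambda>\<omega>. (Js \<omega>)\<^sup>2)"
  shows "expectation (\<lambda>\<omega>. Z \<omega> * (Jt \<omega> - Js \<omega>)) = 0"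
proof -
  obtain n \<tau> \<xi> where el: "\<And>m. elementary M F t (n m) (\<tau> m) (\<xi> m)"
    and l1: "(\<lambda>m. square_norm M t (\<lambda>s \<omega>. f s \<omega> - elementary_process (n m) (\<tau> m) (\<xi> m) s \<omega>)) \<longlonglongrightarrow> 0"
      (is "?x \<longlonglongrightarrow> 0")
    and l2: "(\<lambda>m. \<integral>\<^sup>+\<omega>. ennreal ((Jt \<omega> - elementary_integral W (n m) (\<tau> m) (\<xi> m) \<omega>)\<^sup>2) \<partial>M) \<longlonglongrightarrow> 0"
      (is "?y \<longlonglongrightarrow> 0")
    and "jointly_measurable M t f" and Jtm[measurable]: "Jt \<in> borel_measurable M"
    by (rule ito_integral_approx[OF Jt]) (rule that; assumption)
  obtain n' \<tau>' \<xi>' where el': "\<And>m. elementary M F s (n' m) (\<tau>' m) (\<xi>' m)"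
    and l1': "(\<lambda>m. square_norm M s (\<lambda>s \<omega>. f s \<omega> - elementary_process (n' m) (\<tau>' m) (\<xi>' m) s \<omega>)) \<longlonglongrightarrow> 0"
      (is "?x' \<longlonglongrightarrow> 0")
    and l2': "(\<lambda>m. \<integral>\<^sup>+\<omega>. ennreal ((Js \<omega> - elementary_integral W (n' m) (\<tau>' m) (\<xi>' m) \<omega>)\<^sup>2) \<partial>M) \<longlonglongrightarrow> 0"
      (is "?y' \<longlonglongrightarrow> 0")
    and f: "jointly_measurable M s f" and Jsm[measurable]: "Js \<in> borel_measurable M"
    by (rule ito_integral_approx[OF Js]) (rule that; assumption)
  define I where "I m = elementary_integral W (n m) (\<tau> m) (\<xi> m)" for m
  define I' where "I' m = elementary_integral W (n' m) (\<tau>' m) (\<xi>' m)" for m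
  define R where "R m \<omega> = (\<Sum>i<n m. \<xi> m i \<omega> * (W (max (\<tau> m (Suc i)) s) \<omega> - W (max (\<tau> m i) s) \<omega>))" for m \<omega>
  define D where "D m \<omega> = I m \<omega> - R m \<omega> - I' m \<omega>" for m \<omega>
  note \<tau> = elementary_times[OF el] and \<tau>' = elementary_times[OF el']
  have \<tau>_Suc: "\<tau> m i \<le> \<tau> m (Suc i)" "\<xi> m i \<in> borel_measurable (F (\<tau> m i))"
      "\<exists>C. \<forall>\<omega>\<in>space M. \<bar>\<xi> m i \<omega>\<bar> \<le> C" if "i < n m" for m i
    using el[of m] that by (auto simp: elementary_def)
  have \<tau>'_Suc: "\<tau>' m i \<le> \<tau>' m (Suc i)" "\<xi>' m i \<in> borel_measurable (F (\<tau>' m i))"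
      "\<exists>C. \<forall>\<omega>\<in>space M. \<bar>\<xi>' m i \<omega>\<bar> \<le> C" if "i < n' m" for m i
    using el'[of m] that by (auto simp: elementary_def)
  have [measurable]: "I m \<in> borel_measurable M" "I' m \<in> borel_measurable M" for m
    unfolding I_def I'_def
    by (rule measurable_F_M[OF elementary_integral_measurable[OF el]]
      measurable_F_M[OF elementary_integral_measurable[OF el']])+
  have ZM[measurable]: "Z \<in> borel_measurable M"
    by (rule measurable_F_M[OF Z(1)])
  have Zint: "integrable M Z"
    using ZM Z(2) square_integrable_imp_integrable by blast
  \<comment> \<open>Clipping with \<open>max\<close> makes every increment start at or after
    \<open>s\<close>, at a time when both \<open>Z\<close> and the coefficient are known.\<close>
  have R0: "has_bochner_integral M (\<lambda>\<omega>. Z \<omega> * R m \<omega>) 0" for m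
  proof -
    have "has_bochner_integral M (\<lambda>\<omega>. \<Sum>i<n m. (Z \<omega> * \<xi> m i \<omega>) * (W (max (\<tau> m (Suc i)) s) \<omega> - W (max (\<tau> m i) s) \<omega>))
      (\<Sum>i<n m. 0)"
    proof (intro has_bochner_integral_sum)
      fix i assume "i \<in> {..<n m}"
      then have i: "i < n m" by simp
      have "(\<lambda>\<omega>. Z \<omega> * \<xi> m i \<omega>) \<in> borel_measurable (F (max (\<tau> m i) s))"
        by (intro borel_measurable_times measurable_F_mono[OF Z(1)] measurable_F_mono[OF \<tau>_Suc(2)[OF i]]) auto
      moreover have "integrable M (\<lambda>\<omega>. Z \<omega> * \<xi> m i \<omega>)"
        using integrable_bounded_mult[OF measurable_F_M[OF \<tau>_Suc(2)[OF i]] \<tau>_Suc(3)[OF i] Zint]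
        by (simp add: mult.commute)
      ultimately show "has_bochner_integral M
          (\<lambda>\<omega>. (Z \<omega> * \<xi> m i \<omega>) * (W (max (\<tau> m (Suc i)) s) \<omega> - W (max (\<tau> m i) s) \<omega>)) 0"
        using integral_mult_increment(1,2)[of "max (\<tau> m i) s" "max (\<tau> m (Suc i)) s" "\<lambda>\<omega>. Z \<omega> * \<xi> m i \<omega>"]
          \<tau>_Suc(1)[OF i] st by (auto simp: has_bochner_integral_iff)
    qed
    then show ?thesis
      unfolding R_def by (simp add: sum_distrib_left mult.assoc)
  qed
  have [measurable]: "R m \<in> borel_measurable M" for m
    unfolding R_def
  proof (intro borel_measurable_sum borel_measurable_times borel_measurable_diff W_measurable)
    fix i assume "i \<in> {..<n m}"
    then show "\<xi> m i \<in> borel_measurable M"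
      by (intro measurable_F_M[OF \<tau>_Suc(2)]) auto
  qed (use st in auto)
  have Dn: "(\<integral>\<^sup>+\<omega>. ennreal ((D m \<omega>)\<^sup>2) \<partial>M) \<le> 2 * ?x m + 2 * ?x' m" for m
  proof -
    define K where "K = {..<n m} <+> {..<n' m}"
    define a where "a = case_sum (\<lambda>i. min (\<tau> m i) s) (\<tau>' m)"
    define b where "b = case_sum (\<lambda>i. min (\<tau> m (Suc i)) s) (\<lambda>i. \<tau>' m (Suc i))"
    \<comment> \<open>An interval that begins after \<open>s\<close> is clipped to an empty one
      starting at \<open>s\<close>, but its coefficient is only known later. Replacing that
      coefficient by 0 makes \<open>\<zeta> i\<close> measurable at \<open>a i\<close> and changes
      no integral.\<close>
    define \<zeta> where "\<zeta> = case_sum (\<lambda>i \<omega>. if \<tau> m i \<le> s then \<xi> m i \<omega> else 0) (\<lambda>i \<omega>. - \<xi>' m i \<omega>)"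
    have DK: "D m \<omega> = (\<Sum>i\<in>K. \<zeta> i \<omega> * (W (b i) \<omega> - W (a i) \<omega>))" for \<omega>
    proof -
      have "I m \<omega> - R m \<omega>
        = (\<Sum>i<n m. (if \<tau> m i \<le> s then \<xi> m i \<omega> else 0) * (W (min (\<tau> m (Suc i)) s) \<omega> - W (min (\<tau> m i) s) \<omega>))"
        unfolding I_def R_def elementary_integral_def sum_subtractf[symmetric]
      proof (rule sum.cong[OF refl])
        fix i assume "i \<in> {..<n m}"
        then have "\<tau> m i \<le> \<tau> m (Suc i)" using \<tau>_Suc by simp
        then consider "\<tau> m (Suc i) \<le> s" "\<tau> m i \<le> s" | "\<tau> m i \<le> s" "s < \<tau> m (Suc i)"
          | "s < \<tau> m i" "s < \<tau> m (Suc i)" by linarith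
        then show "\<xi> m i \<omega> * (W (\<tau> m (Suc i)) \<omega> - W (\<tau> m i) \<omega>)
            - \<xi> m i \<omega> * (W (max (\<tau> m (Suc i)) s) \<omega> - W (max (\<tau> m i) s) \<omega>)
          = (if \<tau> m i \<le> s then \<xi> m i \<omega> else 0) * (W (min (\<tau> m (Suc i)) s) \<omega> - W (min (\<tau> m i) s) \<omega>)"
          by cases (auto simp: max_def min_def algebra_simps)
      qed
      then show ?thesis
        unfolding D_def K_def a_def b_def \<zeta>_def I'_def elementary_integral_def
        by (simp add: sum.Plus o_def sum_negf)
    qed
    have order: "0 \<le> a i \<and> a i \<le> b i \<and> b i \<le> s" if "i \<in> K" for i
      using that \<tau>[of _ m] \<tau>'[of _ m] st \<tau>_Suc(1)[of _ m] \<tau>'_Suc(1)[of _ m]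
      by (auto simp: K_def a_def b_def min_le_iff_disj)
    have meas: "\<zeta> i \<in> borel_measurable (F (a i))" if "i \<in> K" for i
    proof (cases i)
      case (Inl j)
      then show ?thesis
        using that \<tau>_Suc(2)[of j m] by (cases "\<tau> m j \<le> s") (auto simp: K_def a_def \<zeta>_def)
    qed (use that \<tau>'_Suc(2)[of _ m] in \<open>auto simp: K_def a_def \<zeta>_def\<close>)
    have bdd: "\<exists>C. \<forall>\<omega>\<in>space M. \<bar>\<zeta> i \<omega>\<bar> \<le> C" if "i \<in> K" for i
    proof (cases i)
      case (Inl j)
      then show ?thesis
        using that \<tau>_Suc(3)[of j m] by (cases "\<tau> m j \<le> s") (auto simp: K_def \<zeta>_def)
    qed (use that \<tau>'_Suc(3)[of _ m] in \<open>auto simp: K_def \<zeta>_def\<close>)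
    have "(\<integral>\<^sup>+\<omega>. ennreal ((D m \<omega>)\<^sup>2) \<partial>M) = square_norm M s (\<lambda>r \<omega>. \<Sum>i\<in>K. \<zeta> i \<omega> * indicator {a i..<b i} r)"
      unfolding DK square_norm_def by (rule simple_isometry) (use order meas bdd in \<open>auto simp: K_def\<close>)
    also have "\<dots> \<le> 2 * square_norm M s (\<lambda>r \<omega>. f r \<omega> - elementary_process (n m) (\<tau> m) (\<xi> m) r \<omega>) + 2 * ?x' m"
    proof (rule square_norm_le)
      show "jointly_measurable M s (\<lambda>r \<omega>. f r \<omega> - elementary_process (n m) (\<tau> m) (\<xi> m) r \<omega>)"
        "jointly_measurable M s (\<lambda>r \<omega>. f r \<omega> - elementary_process (n' m) (\<tau>' m) (\<xi>' m) r \<omega>)"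
        by (intro jointly_measurable_diff f jointly_measurable_elementary[OF el] jointly_measurable_elementary[OF el'])+
      show "jointly_measurable M s (\<lambda>r \<omega>. \<Sum>i\<in>K. \<zeta> i \<omega> * indicator {a i..<b i} r)"
        by (intro jointly_measurable_simple measurable_F_M[OF meas])
      fix r \<omega> assume r: "r \<in> {0..s}"
      show "\<bar>\<Sum>i\<in>K. \<zeta> i \<omega> * indicator {a i..<b i} r\<bar>
        \<le> \<bar>f r \<omega> - elementary_process (n m) (\<tau> m) (\<xi> m) r \<omega>\<bar> + \<bar>f r \<omega> - elementary_process (n' m) (\<tau>' m) (\<xi>' m) r \<omega>\<bar>"
      \<comment> \<open>The endpoint is separate: all clipped intervals are half open and miss
        \<open>s\<close>, while the elementary process on \<open>[0, t)\<close> may be nonzero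
        there.\<close>
      proof (cases "r = s")
        case True
        have "(\<Sum>i\<in>K. \<zeta> i \<omega> * indicator {a i..<b i} r) = 0"
          using order True by (intro sum.neutral) (force simp: indicator_def)
        then show ?thesis by simp
      next
        case False
        with r have rs: "r < s" by simp
        have "(\<Sum>i<n m. (if \<tau> m i \<le> s then \<xi> m i \<omega> else 0) * indicator {min (\<tau> m i) s..<min (\<tau> m (Suc i)) s} r)
          = elementary_process (n m) (\<tau> m) (\<xi> m) r \<omega>"
          unfolding elementary_process_def
          by (rule sum.cong[OF refl]) (use rs in \<open>auto simp: indicator_def\<close>)
        then have "(\<Sum>i\<in>K. \<zeta> i \<omega> * indicator {a i..<b i} r)
          = elementary_process (n m) (\<tau> m) (\<xi> m) r \<omega> - elementary_process (n' m) (\<tau>' m) (\<xi>' m) r \<omega>"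
          unfolding K_def a_def b_def \<zeta>_def
          by (simp add: sum.Plus o_def sum_negf elementary_process_def[of "n' m"] del: sum_mult_indicator)
        then show ?thesis by linarith
      qed
    qed
    also have "\<dots> \<le> 2 * ?x m + 2 * ?x' m"
      using st by (intro add_right_mono mult_left_mono square_norm_mono) auto
    finally show ?thesis .
  qed
  let ?G = "\<lambda>m \<omega>. Jt \<omega> - Js \<omega> - R m \<omega>"
  \<comment> \<open>The decomposition is \<open>Jt - Js - R = (Jt - I) + (D - (Js - I'))\<close>, in
    which every piece is small in mean square.\<close>
  have Gn: "(\<integral>\<^sup>+\<omega>. ennreal ((?G m \<omega>)\<^sup>2) \<partial>M) \<le> 2 * ?y m + 2 * (2 * (2 * ?x m + 2 * ?x' m) + 2 * ?y' m)" for m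
  proof -
    have [measurable]: "D m \<in> borel_measurable M"
      unfolding D_def by measurable
    have "(\<integral>\<^sup>+\<omega>. ennreal ((?G m \<omega>)\<^sup>2) \<partial>M)
      \<le> 2 * (\<integral>\<^sup>+\<omega>. ennreal ((Jt \<omega> - I m \<omega>)\<^sup>2) \<partial>M) + 2 * (\<integral>\<^sup>+\<omega>. ennreal ((D m \<omega> - (Js \<omega> - I' m \<omega>))\<^sup>2) \<partial>M)"
      by (rule nn_integral_square_le) (auto simp: D_def)
    also have "(\<integral>\<^sup>+\<omega>. ennreal ((D m \<omega> - (Js \<omega> - I' m \<omega>))\<^sup>2) \<partial>M)
      \<le> 2 * (\<integral>\<^sup>+\<omega>. ennreal ((D m \<omega>)\<^sup>2) \<partial>M) + 2 * (\<integral>\<^sup>+\<omega>. ennreal ((Js \<omega> - I' m \<omega>)\<^sup>2) \<partial>M)"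
      by (rule nn_integral_square_le) auto
    also have "(\<integral>\<^sup>+\<omega>. ennreal ((D m \<omega>)\<^sup>2) \<partial>M) \<le> 2 * ?x m + 2 * ?x' m"
      by (rule Dn)
    finally show ?thesis
      unfolding I_def I'_def by (simp add: add_mono mult_left_mono)
  qed
  have ZJ: "integrable M (\<lambda>\<omega>. Z \<omega> * (Jt \<omega> - Js \<omega>))"
    using integrable_mult_square_integrable[OF ZM Jtm Z(2) J2(1)]
      integrable_mult_square_integrable[OF ZM Jsm Z(2) J2(2)]
    by (simp add: right_diff_distrib)
  show ?thesis
  proof (rule integral_mult_eq_0_limit[where G = ?G])
    show "Z \<in> borel_measurable M" "integrable M (\<lambda>\<omega>. (Z \<omega>)\<^sup>2)" by fact+
    show "?G m \<in> borel_measurable M" for m by measurable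
    have split: "Z \<omega> * ?G m \<omega> = Z \<omega> * (Jt \<omega> - Js \<omega>) - Z \<omega> * R m \<omega>" for \<omega> m
      by (rule right_diff_distrib)
    show "integrable M (\<lambda>\<omega>. Z \<omega> * ?G m \<omega>)" for m
      unfolding split using ZJ R0[of m] by (auto simp: has_bochner_integral_iff)
    show "expectation (\<lambda>\<omega>. Z \<omega> * (Jt \<omega> - Js \<omega>)) = expectation (\<lambda>\<omega>. Z \<omega> * ?G m \<omega>)" for m
      unfolding split using ZJ R0[of m] by (simp add: has_bochner_integral_iff)
    have "(\<lambda>m. 2 * ?y m + 2 * (2 * (2 * ?x m + 2 * ?x' m) + 2 * ?y' m))
        \<longlonglongrightarrow> 2 * 0 + 2 * (2 * (2 * 0 + 2 * 0) + 2 * 0)"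
      by (intro tendsto_add ennreal_tendsto_cmult l1 l2 l1' l2') auto
    then have lim: "(\<lambda>m. 2 * ?y m + 2 * (2 * (2 * ?x m + 2 * ?x' m) + 2 * ?y' m)) \<longlonglongrightarrow> 0"
      by simp
    show "(\<lambda>m. \<integral>\<^sup>+\<omega>. ennreal ((?G m \<omega>)\<^sup>2) \<partial>M) \<longlonglongrightarrow> 0"
      by (rule tendsto_sandwich[OF _ _ tendsto_const lim]) (use Gn in auto)
  qed
qed

end

section \<open>Maximal inequalities\<close>

context wiener_space
begin

text \<open>First-passage argument: if \<open>i\<close> is the first index with
  \<open>c \<le> \<bar>S i \<omega>\<bar>\<close>, then (S n)^2 \<ge> (S i)^2 + 2 (S i) (S n - S i).
  The factor \<open>g i\<close>, which is \<open>S i\<close> on the first-passage event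
  \<open>A i\<close> and 0 elsewhere, is known at time \<open>t i\<close>, so the cross term has
  mean 0. The martingale property thus enters only as orthogonality of \<open>S n - S i\<close> to
  square integrable variables of the past.\<close>

lemma kolmogorov_maximal_inequality:
  fixes S :: "nat \<Rightarrow> 'w \<Rightarrow> real" and t :: "nat \<Rightarrow> real"
  assumes t: "mono t"
    and S: "\<And>i. i \<le> n \<Longrightarrow> S i \<in> borel_measurable (F (t i))"
      "\<And>i. i \<le> n \<Longrightarrow> integrable M (\<lambda>\<omega>. (S i \<omega>)\<^sup>2)"
    and orth: "\<And>i Z. i \<le> n \<Longrightarrow> Z \<in> borel_measurable (F (t i)) \<Longrightarrow> integrable M (\<lambda>\<omega>. (Z \<omega>)\<^sup>2) \<Longrightarrow>
      expectation (\<lambda>\<omega>. Z \<omega> * (S n \<omega> - S i \<omega>)) = 0"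
    and c: "0 < c"
  shows "c\<^sup>2 * prob {\<omega> \<in> space M. \<exists>i\<le>n. c \<le> \<bar>S i \<omega>\<bar>} \<le> expectation (\<lambda>\<omega>. (S n \<omega>)\<^sup>2)"
proof -
  define E where "E = {\<omega> \<in> space M. \<exists>i\<le>n. c \<le> \<bar>S i \<omega>\<bar>}"
  define A where "A i = {\<omega> \<in> space M. c \<le> \<bar>S i \<omega>\<bar> \<and> (\<forall>j<i. \<not> c \<le> \<bar>S j \<omega>\<bar>)}" for i
  define g where "g i \<omega> = indicator (A i) \<omega> * S i \<omega>" for i \<omega>
  have SM[measurable]: "S i \<in> borel_measurable M" if "i \<le> n" for i
    using measurable_F_M[OF S(1)[OF that]] .
  have E[measurable]: "E \<in> events"
  proof -
    have "E = (\<Union>i\<in>{..n}. {\<omega> \<in> space M. c \<le> \<bar>S i \<omega>\<bar>})" by (auto simp: E_def)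
    then show ?thesis using SM by (auto intro!: sets.finite_UN)
  qed
  have gF: "g i \<in> borel_measurable (F (t i))" if i: "i \<le> n" for i
  proof -
    have Sj[measurable]: "S j \<in> borel_measurable (F (t i))" if "j \<le> i" for j
      using that i measurable_F_mono[OF S(1)] t by (auto simp: mono_def)
    have "A i = {\<omega> \<in> space (F (t i)). c \<le> \<bar>S i \<omega>\<bar>} - (\<Union>j\<in>{..<i}. {\<omega> \<in> space (F (t i)). c \<le> \<bar>S j \<omega>\<bar>})"
      by (auto simp: A_def space_F)
    also have "\<dots> \<in> sets (F (t i))"
      using Sj by (intro sets.Diff sets.finite_UN) auto
    finally show ?thesis
      unfolding g_def using Sj[of i] by (intro borel_measurable_times borel_measurable_indicator) auto
  qed
  have g2: "integrable M (\<lambda>\<omega>. (g i \<omega>)\<^sup>2)" if i: "i \<le> n" for i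
  proof (rule Bochner_Integration.integrable_bound[OF S(2)[OF i]])
    show "(\<lambda>\<omega>. (g i \<omega>)\<^sup>2) \<in> borel_measurable M"
      using measurable_F_M[OF gF[OF i]] by measurable
  qed (auto simp: g_def indicator_def)
  have int: "integrable M (\<lambda>\<omega>. g i \<omega> * (S n \<omega> - S i \<omega>))" if i: "i \<le> n" for i
    using integrable_mult_square_integrable[OF measurable_F_M[OF gF[OF i]] SM g2[OF i] S(2), of n]
      integrable_mult_square_integrable[OF measurable_F_M[OF gF[OF i]] SM g2[OF i] S(2), of i] i
    by (simp add: right_diff_distrib)
  have pointwise: "c\<^sup>2 * indicator E \<omega> + 2 * (\<Sum>i\<le>n. g i \<omega> * (S n \<omega> - S i \<omega>)) \<le> (S n \<omega>)\<^sup>2"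
    if \<omega>: "\<omega> \<in> space M" for \<omega>
  proof (cases "\<omega> \<in> E")
    case False
    then have "g i \<omega> = 0" if "i \<le> n" for i
      using that \<omega> by (auto simp: g_def A_def E_def)
    then show ?thesis using False by simp
  next
    case True
    define i where "i = (LEAST i. c \<le> \<bar>S i \<omega>\<bar>)"
    obtain i' where i': "i' \<le> n" "c \<le> \<bar>S i' \<omega>\<bar>" using True by (auto simp: E_def)
    have i: "c \<le> \<bar>S i \<omega>\<bar>" "i \<le> n"
      unfolding i_def using LeastI[of "\<lambda>i. c \<le> \<bar>S i \<omega>\<bar>", OF i'(2)]
        Least_le[of "\<lambda>i. c \<le> \<bar>S i \<omega>\<bar>", OF i'(2)] i'(1) by auto
    have min: "\<not> c \<le> \<bar>S j \<omega>\<bar>" if "j < i" for j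
      using that unfolding i_def by (rule not_less_Least)
    have "\<omega> \<in> A j \<longleftrightarrow> j = i" for j
      using \<omega> i(1) min by (auto simp: A_def) (metis linorder_neqE_nat)
    then have "(\<Sum>j\<le>n. g j \<omega> * (S n \<omega> - S j \<omega>)) = (\<Sum>j\<le>n. if j = i then S i \<omega> * (S n \<omega> - S i \<omega>) else 0)"
      by (intro sum.cong) (auto simp: g_def)
    also have "\<dots> = S i \<omega> * (S n \<omega> - S i \<omega>)"
      using i(2) by simp
    finally have "(S n \<omega>)\<^sup>2 - 2 * (\<Sum>j\<le>n. g j \<omega> * (S n \<omega> - S j \<omega>)) = (S i \<omega>)\<^sup>2 + (S n \<omega> - S i \<omega>)\<^sup>2"
      by (simp add: power2_eq_square algebra_simps)
    moreover have "c\<^sup>2 \<le> (S i \<omega>)\<^sup>2"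
      using power_mono[OF i(1), of 2] c by simp
    ultimately have "c\<^sup>2 + 2 * (\<Sum>j\<le>n. g j \<omega> * (S n \<omega> - S j \<omega>)) \<le> (S n \<omega>)\<^sup>2"
      using zero_le_power2[of "S n \<omega> - S i \<omega>"] by linarith
    then show ?thesis using True by simp
  qed
  have intE: "integrable M (indicat_real E)"
    using E by (simp add: less_top[symmetric])
  have intg: "integrable M (\<lambda>\<omega>. \<Sum>i\<le>n. g i \<omega> * (S n \<omega> - S i \<omega>))"
    using int by (intro Bochner_Integration.integrable_sum) auto
  have "expectation (\<lambda>\<omega>. \<Sum>i\<le>n. g i \<omega> * (S n \<omega> - S i \<omega>)) = 0"
    using int orth[OF _ gF g2] by (subst Bochner_Integration.integral_sum) auto
  then have "c\<^sup>2 * prob E = expectation (\<lambda>\<omega>. c\<^sup>2 * indicator E \<omega> + 2 * (\<Sum>i\<le>n. g i \<omega> * (S n \<omega> - S i \<omega>)))"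
    using intE intg E by simp
  also have "\<dots> \<le> expectation (\<lambda>\<omega>. (S n \<omega>)\<^sup>2)"
    by (rule integral_mono) (use pointwise S(2) intE intg in auto)
  finally show ?thesis by (simp add: E_def)
qed

text \<open>The bound on a grid does not depend on its mesh, and the grids are nested (point
  \<open>i\<close> of level \<open>n\<close> is point \<open>2 * i\<close> of the next level). The
  events therefore increase, and continuity from below covers all dyadic times at once. An adapted
  version \<open>S\<close> is used because first-passage events have to lie in the
  filtration.\<close>

lemma ito_integral_maximal_inequality:
  fixes S :: "real \<Rightarrow> 'w \<Rightarrow> real"
  assumes S: "\<And>t. 0 \<le> t \<Longrightarrow> S t \<in> borel_measurable (F t)"
    and J: "\<And>t. 0 \<le> t \<Longrightarrow> \<exists>J. has_ito_integral M F W f t J \<and> (AE \<omega> in M. J \<omega> = S t \<omega>)"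
    and bound: "\<And>s \<omega>. 0 \<le> s \<Longrightarrow> \<omega> \<in> space M \<Longrightarrow> \<bar>f s \<omega>\<bar> \<le> C"
    and "0 < c" and T: "0 \<le> T"
  shows "prob {\<omega> \<in> space M. \<exists>n. \<exists>i\<le>2 ^ n. c \<le> \<bar>S (real i * T / 2 ^ n) \<omega>\<bar>} \<le> 4 * C\<^sup>2 * T / c\<^sup>2"
proof -
  have SM[measurable]: "S t \<in> borel_measurable M" if "0 \<le> t" for t
    by (rule measurable_F_M[OF S[OF that]])
  obtain I where I: "\<And>t. 0 \<le> t \<Longrightarrow> has_ito_integral M F W f t (I t)"
    and IS: "\<And>t. 0 \<le> t \<Longrightarrow> AE \<omega> in M. I t \<omega> = S t \<omega>"
    using J by metis
  have IM[measurable]: "I t \<in> borel_measurable M" if "0 \<le> t" for t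
    using I[OF that] by (simp add: has_ito_integral_def)
  have I2: "(\<integral>\<^sup>+\<omega>. ennreal ((I t \<omega>)\<^sup>2) \<partial>M) \<le> ennreal (4 * C\<^sup>2 * t)" if "0 \<le> t" for t
    by (rule ito_integral_square_le[OF I[OF that] that]) (use bound in auto)
  have I_int: "integrable M (\<lambda>\<omega>. (I t \<omega>)\<^sup>2)" if "0 \<le> t" for t
    using I2[OF that] by (subst integrable_square_iff[OF IM[OF that]]) (auto intro: le_less_trans)
  have IS2: "AE \<omega> in M. (I t \<omega>)\<^sup>2 = (S t \<omega>)\<^sup>2" if "0 \<le> t" for t
    using IS[OF that] by eventually_elim simp
  have S_int: "integrable M (\<lambda>\<omega>. (S t \<omega>)\<^sup>2)" if "0 \<le> t" for t
    using I_int[OF that] IS2[OF that] integrable_cong_AE[of "\<lambda>\<omega>. (I t \<omega>)\<^sup>2" M "\<lambda>\<omega>. (S t \<omega>)\<^sup>2"]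
      SM[OF that] IM[OF that] by auto
  have S_exp: "expectation (\<lambda>\<omega>. (S t \<omega>)\<^sup>2) \<le> 4 * C\<^sup>2 * t" if t: "0 \<le> t" for t
  proof -
    have "expectation (\<lambda>\<omega>. (S t \<omega>)\<^sup>2) = expectation (\<lambda>\<omega>. (I t \<omega>)\<^sup>2)"
      using IS2[OF t] SM[OF t] IM[OF t] by (intro integral_cong_AE) auto
    moreover have "ennreal (expectation (\<lambda>\<omega>. (I t \<omega>)\<^sup>2)) \<le> ennreal (4 * C\<^sup>2 * t)"
      using I2[OF t] nn_integral_eq_integral[OF I_int[OF t]] by simp
    ultimately show ?thesis using t by (simp add: ennreal_le_iff)
  qed
  have orth: "expectation (\<lambda>\<omega>. Z \<omega> * (S t \<omega> - S s \<omega>)) = 0"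
    if st: "0 \<le> s" "s \<le> t" and Z: "Z \<in> borel_measurable (F s)" "integrable M (\<lambda>\<omega>. (Z \<omega>)\<^sup>2)" for s t Z
  proof -
    have t: "0 \<le> t" using st by simp
    note [measurable] = measurable_F_M[OF Z(1)] SM[OF st(1)] SM[OF t] IM[OF st(1)] IM[OF t]
    have "expectation (\<lambda>\<omega>. Z \<omega> * (S t \<omega> - S s \<omega>)) = expectation (\<lambda>\<omega>. Z \<omega> * (I t \<omega> - I s \<omega>))"
    proof (rule integral_cong_AE)
      show "AE \<omega> in M. Z \<omega> * (S t \<omega> - S s \<omega>) = Z \<omega> * (I t \<omega> - I s \<omega>)"
        using IS[OF st(1)] IS[OF t] by eventually_elim simp
    qed measurable
    also have "\<dots> = 0"
      by (rule ito_integral_orthogonal_increment[OF I[OF t] I[OF st(1)] st Z I_int[OF t] I_int[OF st(1)]])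
    finally show ?thesis .
  qed
  define E where "E n = {\<omega> \<in> space M. \<exists>i\<le>2 ^ n. c \<le> \<bar>S (real i * T / 2 ^ n) \<omega>\<bar>}" for n :: nat
  have E[measurable]: "E n \<in> events" for n
  proof -
    have "E n = (\<Union>i\<in>{..2 ^ n}. {\<omega> \<in> space M. c \<le> \<bar>S (real i * T / 2 ^ n) \<omega>\<bar>})" by (auto simp: E_def)
    moreover have "{\<omega> \<in> space M. c \<le> \<bar>S (real i * T / 2 ^ n) \<omega>\<bar>} \<in> events" for i
    proof -
      have "0 \<le> real i * T / 2 ^ n"
        using T by (intro divide_nonneg_nonneg mult_nonneg_nonneg) auto
      note [measurable] = SM[OF this]
      show ?thesis by measurable
    qed
    ultimately show ?thesis by (auto intro!: sets.finite_UN)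
  qed
  have "incseq E"
  proof (rule incseq_SucI, rule subsetI)
    fix n \<omega> assume "\<omega> \<in> E n"
    then obtain i where i: "\<omega> \<in> space M" "i \<le> 2 ^ n" "c \<le> \<bar>S (real i * T / 2 ^ n) \<omega>\<bar>"
      by (auto simp: E_def)
    then have "2 * i \<le> 2 ^ Suc n" "c \<le> \<bar>S (real (2 * i) * T / 2 ^ Suc n) \<omega>\<bar>" by auto
    with i(1) show "\<omega> \<in> E (Suc n)" unfolding E_def by blast
  qed
  then have "(\<lambda>n. prob (E n)) \<longlonglongrightarrow> prob (\<Union>n. E n)"
    by (intro finite_Lim_measure_incseq) auto
  moreover have "prob (E n) \<le> 4 * C\<^sup>2 * T / c\<^sup>2" for n
  proof -
    let ?t = "\<lambda>i. real i * T / 2 ^ n"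
    have t0: "0 \<le> ?t i" for i
      using T by (intro divide_nonneg_nonneg mult_nonneg_nonneg) auto
    have t1: "?t i \<le> ?t (2 ^ n)" if "i \<le> 2 ^ n" for i
    proof -
      have "real i \<le> 2 ^ n" using that by (metis of_nat_le_iff of_nat_numeral of_nat_power)
      then show ?thesis using T by (intro divide_right_mono mult_right_mono) auto
    qed
    have "c\<^sup>2 * prob (E n) \<le> expectation (\<lambda>\<omega>. (S (?t (2 ^ n)) \<omega>)\<^sup>2)"
      unfolding E_def
    proof (rule kolmogorov_maximal_inequality[where t = ?t])
      show "mono ?t" using T by (intro monoI divide_right_mono mult_right_mono) auto
      show "S (?t i) \<in> borel_measurable (F (?t i))" "integrable M (\<lambda>\<omega>. (S (?t i) \<omega>)\<^sup>2)" for i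
        by (rule S[OF t0] S_int[OF t0])+
      show "expectation (\<lambda>\<omega>. Z \<omega> * (S (?t (2 ^ n)) \<omega> - S (?t i) \<omega>)) = 0"
        if "i \<le> 2 ^ n" "Z \<in> borel_measurable (F (?t i))" "integrable M (\<lambda>\<omega>. (Z \<omega>)\<^sup>2)" for i Z
        by (rule orth[OF t0 t1[OF that(1)] that(2,3)])
    qed fact
    also have "\<dots> \<le> 4 * C\<^sup>2 * T"
      using S_exp[of T] T by simp
    finally show ?thesis
      using \<open>0 < c\<close> by (simp add: field_simps)
  qed
  ultimately have "prob (\<Union>n. E n) \<le> 4 * C\<^sup>2 * T / c\<^sup>2"
    by (intro LIMSEQ_le_const2) auto
  moreover have "(\<Union>n. E n) = {\<omega> \<in> space M. \<exists>n. \<exists>i\<le>2 ^ n. c \<le> \<bar>S (real i * T / 2 ^ n) \<omega>\<bar>}"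
    by (auto simp: E_def)
  ultimately show ?thesis by simp
qed

end

section \<open>From dyadic times to all times\<close>

lemma bound_from_dyadic:
  fixes g :: "real \<Rightarrow> real"
  assumes cont: "continuous_on {0..T} g" and t: "0 \<le> t" "t \<le> T"
    and le: "\<And>n i. i \<le> 2 ^ n \<Longrightarrow> \<bar>g (real i * T / 2 ^ n)\<bar> \<le> c"
  shows "\<bar>g t\<bar> \<le> c"
proof (cases "T = 0")
  case True
  then show ?thesis using le[of 0 0] t by simp
next
  case False
  with t have T: "0 < T" by simp
  \<comment> \<open>\<open>x n\<close> below is the last grid point of level \<open>n\<close> that
    does not exceed \<open>t\<close>, hence within \<open>T / 2 ^ n\<close> of it.\<close>
  define i where "i n = nat \<lfloor>t * 2 ^ n / T\<rfloor>" for n :: nat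
  define x where "x n = real (i n) * T / 2 ^ n" for n
  have nn: "0 \<le> t * 2 ^ n / T" for n using t T by simp
  have i_le: "real (i n) \<le> t * 2 ^ n / T" and i_ge: "t * 2 ^ n / T - 1 \<le> real (i n)" for n
    using nn[of n] unfolding i_def by (simp_all add: of_nat_nat)
  have x_le: "x n \<le> t" for n
    using i_le[of n] T by (simp add: x_def field_simps)
  have x_ge: "t - T / 2 ^ n \<le> x n" for n
    using mult_right_mono[OF i_ge[of n], of "T / 2 ^ n"] T by (simp add: x_def left_diff_distrib diff_divide_distrib)
  have "i n \<le> 2 ^ n" for n
  proof -
    have "real (i n) \<le> 2 ^ n"
    proof (rule order_trans[OF i_le[of n]])
      show "t * 2 ^ n / T \<le> 2 ^ n"
        using t(2) T by (simp add: pos_divide_le_eq mult.commute)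
    qed
    then show ?thesis by (metis of_nat_le_iff of_nat_numeral of_nat_power)
  qed
  then have gx: "\<bar>g (x n)\<bar> \<le> c" for n
    unfolding x_def by (rule le)
  have "(\<lambda>n. T / 2 ^ n) \<longlonglongrightarrow> 0"
    using LIMSEQ_divide_realpow_zero[of 2 T] by simp
  from tendsto_diff[OF tendsto_const[of t] this]
  have "x \<longlonglongrightarrow> t"
    by (intro tendsto_sandwich[OF _ _ _ tendsto_const[of t], of "\<lambda>n. t - T / 2 ^ n" x])
      (use x_le x_ge in auto)
  moreover have "x n \<in> {0..T}" for n
    using x_le[of n] t T by (auto simp: x_def)
  ultimately have "(\<lambda>n. g (x n)) \<longlonglongrightarrow> g t"
    using cont t by (auto simp: continuous_on_sequentially o_def)
  then have "(\<lambda>n. \<bar>g (x n)\<bar>) \<longlonglongrightarrow> \<bar>g t\<bar>" by (rule tendsto_rabs)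
  then show ?thesis by (rule LIMSEQ_le_const2) (use gx in auto)
qed

text \<open>A time in \<open>[2 ^ k, 2 ^ Suc k)\<close> inherits the bound for
  \<open>2 ^ Suc k\<close>, which is at most twice the time itself. This lost factor 2 is why
  \<open>l\<close> is chosen with \<open>2 / real (Suc l) < e\<close>.\<close>

lemma sublinear_from_dyadic_bounds:
  fixes g :: "real \<Rightarrow> real"
  assumes le: "\<And>l. eventually (\<lambda>m. \<forall>t\<in>{0..2 ^ m}. \<bar>g t\<bar> \<le> 2 ^ m / real (Suc l)) sequentially"
  shows "((\<lambda>t. g t / t) \<longlongrightarrow> 0) at_top"
proof (rule tendstoI)
  fix e :: real assume "0 < e"
  obtain l where "2 / e < real l" using reals_Archimedean2 by blast
  then have l: "2 / real (Suc l) < e" using \<open>0 < e\<close> by (simp add: field_simps)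
  obtain m0 where m0: "\<And>m t. m0 \<le> m \<Longrightarrow> t \<in> {0..2 ^ m} \<Longrightarrow> \<bar>g t\<bar> \<le> 2 ^ m / real (Suc l)"
    using le[of l] unfolding eventually_sequentially by blast
  have "dist (g t / t) 0 < e" if t: "2 ^ m0 \<le> t" for t
  proof -
    have t1: "1 \<le> t" using t by (meson order_trans one_le_power one_le_numeral)
    define n where "n = (LEAST n. t < 2 ^ n)"
    obtain n' where "t < 2 ^ n'" using real_arch_pow[of 2 t] by auto
    then have n: "t < 2 ^ n" unfolding n_def by (rule LeastI)
    have "m0 < n"
      using le_less_trans[OF t n] by simp
    then obtain k where k: "n = Suc k" by (cases n) auto
    have "\<not> t < 2 ^ k"
      using not_less_Least[of k "\<lambda>n. t < 2 ^ n"] k unfolding n_def by simp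
    then have "2 ^ n \<le> 2 * t" by (simp add: k)
    have "\<bar>g t\<bar> \<le> 2 ^ n / real (Suc l)"
      using m0[of n t] \<open>m0 < n\<close> n t1 by simp
    also have "\<dots> \<le> 2 / real (Suc l) * t"
      using \<open>2 ^ n \<le> 2 * t\<close> by (simp add: divide_right_mono)
    also have "\<dots> < e * t"
      using l t1 by (intro mult_strict_right_mono) auto
    finally show ?thesis
      using t1 by (simp add: dist_norm field_simps)
  qed
  then show "\<forall>\<^sub>F t in at_top. dist (g t / t) 0 < e"
    by (rule eventually_mono[OF eventually_ge_at_top])
qed

section \<open>Sublinear growth of the noise\<close>

context wiener_space
begin

text \<open>Two versions share the work: the adapted \<open>S\<close> satisfies the maximal
  inequality but has no path regularity, while \<open>N\<close> has continuous paths but is not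
  assumed adapted. They agree almost surely at all dyadic times, and continuity of \<open>N\<close>
  does the rest.\<close>

lemma ito_integral_sublinear:
  fixes N :: "real \<Rightarrow> 'w \<Rightarrow> real"
  assumes bound: "\<And>s \<omega>. 0 \<le> s \<Longrightarrow> \<omega> \<in> space M \<Longrightarrow> \<bar>f s \<omega>\<bar> \<le> C"
    and cont: "AE \<omega> in M. \<forall>T. continuous_on {0..T} (\<lambda>t. N t \<omega>)"
    and ito: "\<And>t. 0 \<le> t \<Longrightarrow> \<exists>J. has_ito_integral M F W f t J \<and> (AE \<omega> in M. N t \<omega> = J \<omega>)"
  shows "AE \<omega> in M. ((\<lambda>t. N t \<omega> / t) \<longlongrightarrow> 0) at_top"
proof -
  have "\<exists>S. S \<in> borel_measurable (F t) \<and>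
      (\<exists>J. has_ito_integral M F W f t J \<and> (AE \<omega> in M. J \<omega> = S \<omega>) \<and> (AE \<omega> in M. N t \<omega> = J \<omega>))"
    if "0 \<le> t" for t
    using ito[OF that] ito_integral_adapted_version by metis
  then obtain S where S: "\<And>t. 0 \<le> t \<Longrightarrow> S t \<in> borel_measurable (F t)"
    and J: "\<And>t. 0 \<le> t \<Longrightarrow> \<exists>J. has_ito_integral M F W f t J \<and> (AE \<omega> in M. J \<omega> = S t \<omega>) \<and> (AE \<omega> in M. N t \<omega> = J \<omega>)"
    by metis
  have NS: "AE \<omega> in M. N t \<omega> = S t \<omega>" if t: "0 \<le> t" for t
  proof -
    obtain J where "AE \<omega> in M. J \<omega> = S t \<omega>" "AE \<omega> in M. N t \<omega> = J \<omega>" using J[OF t] by auto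
    then show ?thesis by eventually_elim simp
  qed
  define E where "E l m = {\<omega> \<in> space M. \<exists>n. \<exists>i\<le>2 ^ n. 2 ^ m / real (Suc l) \<le> \<bar>S (real i * 2 ^ m / 2 ^ n) \<omega>\<bar>}"
    for l m :: nat
  have E: "E l m \<in> events" for l m
  proof -
    have "E l m = (\<Union>n. \<Union>i\<in>{..2 ^ n}. {\<omega> \<in> space M. 2 ^ m / real (Suc l) \<le> \<bar>S (real i * 2 ^ m / 2 ^ n) \<omega>\<bar>})"
      by (auto simp: E_def)
    moreover have "{\<omega> \<in> space M. 2 ^ m / real (Suc l) \<le> \<bar>S (real i * 2 ^ m / 2 ^ n) \<omega>\<bar>} \<in> events" for i n
    proof -
      have [measurable]: "S (real i * 2 ^ m / 2 ^ n) \<in> borel_measurable M"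
        by (rule measurable_F_M[OF S]) simp
      show ?thesis by measurable
    qed
    ultimately show ?thesis by (auto intro!: sets.countable_UN sets.finite_UN)
  qed
  have "AE \<omega> in M. eventually (\<lambda>m. \<omega> \<in> space M - E l m) sequentially" for l
  proof (rule borel_cantelli_AE1[OF E])
    \<comment> \<open>The second moment at time \<open>2 ^ m\<close> is of order
      \<open>2 ^ m\<close> and the squared threshold of order \<open>4 ^ m\<close>; their ratio is
      geometric, hence summable in \<open>m\<close>.\<close>
    have le: "prob (E l m) \<le> 4 * C\<^sup>2 * (real (Suc l))\<^sup>2 * (1/2) ^ m" for m
    proof -
      have "prob (E l m) \<le> 4 * C\<^sup>2 * 2 ^ m / (2 ^ m / real (Suc l))\<^sup>2"
        unfolding E_def
      proof (rule ito_integral_maximal_inequality[where f = f and S = S and C = C])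
        show "\<exists>J. has_ito_integral M F W f t J \<and> (AE \<omega> in M. J \<omega> = S t \<omega>)" if "0 \<le> t" for t
          using J[OF that] by blast
      qed (use S bound in auto)
      also have "\<dots> = 4 * C\<^sup>2 * (real (Suc l))\<^sup>2 * (1/2) ^ m"
        by (simp add: power_divide power2_eq_square divide_simps del: of_nat_Suc)
      finally show ?thesis .
    qed
    have "summable (\<lambda>m. 4 * C\<^sup>2 * (real (Suc l))\<^sup>2 * (1/2) ^ m)"
      by (intro summable_mult summable_geometric) simp
    then show "summable (\<lambda>m. prob (E l m))"
    proof (rule summable_comparison_test'[where N = 0])
      show "norm (prob (E l m)) \<le> 4 * C\<^sup>2 * (real (Suc l))\<^sup>2 * (1/2) ^ m" for m
        using le[of m] by (simp only: real_norm_def abs_of_nonneg[OF measure_nonneg])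
    qed
  qed (simp add: less_top[symmetric])
  then have bc: "AE \<omega> in M. \<forall>l. eventually (\<lambda>m. \<omega> \<in> space M - E l m) sequentially"
    by (simp add: AE_all_countable)
  \<comment> \<open>\<open>N t = S t\<close> holds off a null set depending on \<open>t\<close>; the
    times used here are countable, so one null set serves them all.\<close>
  have "AE \<omega> in M. \<forall>i m n :: nat. N (real i * 2 ^ m / 2 ^ n) \<omega> = S (real i * 2 ^ m / 2 ^ n) \<omega>"
    unfolding AE_all_countable by (intro allI NS) simp
  with bc cont show ?thesis
  proof eventually_elim
    case (elim \<omega>)
    then have cont_N: "continuous_on {0..T} (\<lambda>t. N t \<omega>)" for T by blast
    show ?case
    proof (rule sublinear_from_dyadic_bounds)
      fix l
      from elim(1) have "eventually (\<lambda>m. \<omega> \<in> space M - E l m) sequentially" by simp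
      then show "eventually (\<lambda>m. \<forall>t\<in>{0..2 ^ m}. \<bar>N t \<omega>\<bar> \<le> 2 ^ m / real (Suc l)) sequentially"
      proof eventually_elim
        case (elim m)
        have "\<bar>N (real i * 2 ^ m / 2 ^ n) \<omega>\<bar> \<le> 2 ^ m / real (Suc l)" if "i \<le> 2 ^ n" for i n
          using elim that \<open>\<forall>i m n. N (real i * 2 ^ m / 2 ^ n) \<omega> = S (real i * 2 ^ m / 2 ^ n) \<omega>\<close>
          by (force simp: E_def)
        then have "\<bar>N t \<omega>\<bar> \<le> 2 ^ m / real (Suc l)" if "0 \<le> t" "t \<le> 2 ^ m" for t
          by (rule bound_from_dyadic[OF cont_N that])
        then show ?case by simp
      qed
    qed
  qed
qed

end

section \<open>Mixed strategies and choice maps\<close>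

lemma mixed_nonneg: "p \<in> mixed B \<Longrightarrow> 0 \<le> p $ \<alpha>"
  by (simp add: mixed_def)

lemma mixed_eq_0: "p \<in> mixed B \<Longrightarrow> \<alpha> \<notin> B \<Longrightarrow> p $ \<alpha> = 0"
  by (simp add: mixed_def)

lemma mixed_sum: "p \<in> mixed B \<Longrightarrow> (\<Sum>\<alpha>\<in>B. p $ \<alpha>) = 1"
  by (simp add: mixed_def)

lemma mixed_le_1: "p \<in> mixed (B :: 'a::finite set) \<Longrightarrow> p $ \<alpha> \<le> 1"
  using member_le_sum[of \<alpha> B "($) p"] mixed_nonneg[of p B] mixed_sum[of p B] mixed_eq_0[of p B \<alpha>]
  by (cases "\<alpha> \<in> B") auto

lemma supp_mixed_nonempty:
  assumes "p \<in> mixed B"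
  shows "supp p \<noteq> {}"
proof
  assume "supp p = {}"
  then have "p $ \<alpha> = 0" for \<alpha> by (auto simp: supp_def)
  then show False using mixed_sum[OF assms] by simp
qed

lemma axis_mixed: "\<alpha> \<in> B \<Longrightarrow> axis \<alpha> 1 \<in> mixed (B :: 'a::finite set)"
  by (auto simp: mixed_def axis_def sum.delta)

lemma supp_axis: "supp (axis \<alpha> 1 :: real^'a::finite) = {\<alpha>}"
  by (auto simp: supp_def axis_def)

lemma compact_mixed: "compact (mixed (B :: 'a::finite set))"
proof -
  have "mixed B = (\<Inter>\<alpha>. {p. 0 \<le> p $ \<alpha>}) \<inter> (\<Inter>\<alpha>\<in>-B. {p. p $ \<alpha> = 0}) \<inter> {p. (\<Sum>\<alpha>\<in>B. p $ \<alpha>) = 1}"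
    by (auto simp: mixed_def)
  moreover have "closed \<dots>"
    by (intro closed_Int closed_INT ballI closed_Collect_le closed_Collect_eq continuous_intros)
  moreover have "bounded (mixed B)"
    unfolding bounded_iff
  proof (intro exI ballI)
    fix p assume p: "p \<in> mixed B"
    have "norm p \<le> (\<Sum>\<alpha>\<in>UNIV. \<bar>p $ \<alpha>\<bar>)"
      by (rule norm_le_l1_cart)
    also have "\<dots> \<le> (\<Sum>\<alpha>\<in>(UNIV :: 'a set). 1)"
      using mixed_nonneg[OF p] mixed_le_1[OF p] by (intro sum_mono) simp
    finally show "norm p \<le> (\<Sum>\<alpha>\<in>(UNIV :: 'a set). 1)" .
  qed
  ultimately show ?thesis
    by (simp add: compact_eq_bounded_closed)
qed

lemma convex_mixed:
  assumes "p \<in> mixed B" "q \<in> mixed B" "0 \<le> s" "0 \<le> t" "s + t = 1"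
  shows "s *\<^sub>R p + t *\<^sub>R q \<in> mixed (B :: 'a::finite set)"
  using assms by (auto simp: mixed_def sum.distrib sum_distrib_left[symmetric])

lemma compact_mixed_profiles:
  "compact (mixed_profiles (A :: 'p::finite \<Rightarrow> 'a::finite set))"
proof -
  have "mixed_profiles A = (\<Inter>k. {x. x $ k \<in> mixed (A k)})"
    by (auto simp: profiles_def)
  moreover have "closed {x :: real^'a^'p. x $ k \<in> mixed (A k)}" for k
    using closed_vimage[OF compact_imp_closed[OF compact_mixed[of "A k"]], of "\<lambda>x. x $ k"]
    by (simp add: vimage_def continuous_intros)
  moreover have "bounded (mixed_profiles A)"
    unfolding bounded_iff
  proof -
    have "\<exists>C. \<forall>q\<in>mixed (A k). norm q \<le> C" for k
      using compact_imp_bounded[OF compact_mixed] by (simp add: bounded_iff)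
    then obtain C where C: "\<And>k q. q \<in> mixed (A k) \<Longrightarrow> norm q \<le> C k" by metis
    have "norm x \<le> sum C UNIV" if "x \<in> mixed_profiles A" for x
    proof -
      have "norm x \<le> (\<Sum>k\<in>UNIV. norm (x $ k))"
        unfolding norm_vec_def by (rule L2_set_le_sum) simp
      also have "\<dots> \<le> sum C UNIV"
        using that C by (intro sum_mono) (auto simp: profiles_def)
      finally show ?thesis .
    qed
    then show "\<exists>C. \<forall>x\<in>mixed_profiles A. norm x \<le> C" by auto
  qed
  ultimately show ?thesis
    by (auto simp: compact_eq_bounded_closed)
qed

section \<open>Choice maps: existence, continuity and extinction\<close>

lemma choice_map_maximizes:
  assumes "penalty B h" "B \<noteq> {}"
  shows "choice_map B h y \<in> mixed B"
    and "x \<in> mixed B \<Longrightarrow> y \<bullet> x - h x \<le> y \<bullet> choice_map B h y - h (choice_map B h y)"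
proof -
  obtain \<alpha> where "\<alpha> \<in> B" using assms(2) by auto
  then have ne: "mixed B \<noteq> {}" using axis_mixed by auto
  have "continuous_on (mixed B) (\<lambda>x. y \<bullet> x - h x)"
    using assms(1) by (auto simp: penalty_def intro!: continuous_intros)
  from continuous_attains_sup[OF compact_mixed ne this]
  obtain x0 where x0: "x0 \<in> mixed B" "\<forall>x\<in>mixed B. y \<bullet> x - h x \<le> y \<bullet> x0 - h x0" by auto
  have "choice_map B h y \<in> mixed B \<and>
    (\<forall>x\<in>mixed B. y \<bullet> x - h x \<le> y \<bullet> choice_map B h y - h (choice_map B h y))"
    unfolding choice_map_def arg_max_on_def
    by (rule arg_maxI[where x = x0]) (use x0 in \<open>auto simp: not_less\<close>)
  then show "choice_map B h y \<in> mixed B"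
    "x \<in> mixed B \<Longrightarrow> y \<bullet> x - h x \<le> y \<bullet> choice_map B h y - h (choice_map B h y)"
    by auto
qed

text \<open>Comparing each maximiser with the midpoint of the two gives quadratic growth of the
  objective away from its maximiser; adding the two growth estimates bounds the distance.\<close>

lemma choice_map_continuity_estimate:
  assumes pen: "penalty B h" and B: "B \<noteq> {}"
  shows "\<exists>K>0. \<forall>y y'. K * (norm (choice_map B h y' - choice_map B h y))\<^sup>2
    \<le> (y' - y) \<bullet> (choice_map B h y' - choice_map B h y)"
proof -
  obtain K where K: "K > 0" and sc: "\<And>x x' t. x \<in> mixed B \<Longrightarrow> x' \<in> mixed B \<Longrightarrow> t \<in> {0..1} \<Longrightarrow>
    h (t *\<^sub>R x + (1 - t) *\<^sub>R x') \<le> t * h x + (1 - t) * h x' - 1/2 * K * t * (1 - t) * (norm (x' - x))\<^sup>2"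
    using pen by (auto simp: penalty_def strongly_convex_on_def)
  let ?Q = "choice_map B h"
  note Q = choice_map_maximizes[OF pen B]
  have growth: "K/4 * (norm (x - ?Q y))\<^sup>2 \<le> (y \<bullet> ?Q y - h (?Q y)) - (y \<bullet> x - h x)" if x: "x \<in> mixed B" for x y
  proof -
    let ?m = "(1/2) *\<^sub>R ?Q y + (1/2) *\<^sub>R x"
    have "?m \<in> mixed B"
      by (rule convex_mixed) (use x Q in auto)
    from Q(2)[OF this, of y]
    have "y \<bullet> ?m - h ?m \<le> y \<bullet> ?Q y - h (?Q y)" .
    moreover have "h ?m \<le> 1/2 * h (?Q y) + 1/2 * h x - K/8 * (norm (x - ?Q y))\<^sup>2"
      using sc[OF Q(1) x, of "1/2" y] by simp
    moreover have "y \<bullet> ?m = 1/2 * (y \<bullet> ?Q y) + 1/2 * (y \<bullet> x)"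
      by (simp add: inner_add_right)
    ultimately show ?thesis by linarith
  qed
  have "K/2 * (norm (?Q y' - ?Q y))\<^sup>2 \<le> (y' - y) \<bullet> (?Q y' - ?Q y)" for y y'
    using growth[OF Q(1), of y' y] growth[OF Q(1), of y y']
    by (simp add: norm_minus_commute inner_diff_left inner_diff_right)
  then show ?thesis using K by (intro exI[of _ "K/2"]) auto
qed

text \<open>Cauchy-Schwarz turns the preceding estimate into the Lipschitz constant
  \<open>1 / K\<close>. This is what makes \<open>X\<close> inherit the path continuity of
  \<open>Y\<close>.\<close>

lemma choice_map_lipschitz:
  assumes "penalty B h" "B \<noteq> {}"
  shows "\<exists>L. L-lipschitz_on UNIV (choice_map B h)"
proof -
  obtain K where K: "K > 0" and est: "\<And>y y'. K * (norm (choice_map B h y' - choice_map B h y))\<^sup>2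
    \<le> (y' - y) \<bullet> (choice_map B h y' - choice_map B h y)"
    using choice_map_continuity_estimate[OF assms] by auto
  have "K * norm (choice_map B h y' - choice_map B h y) \<le> norm (y' - y)" for y y'
  proof (cases "choice_map B h y' = choice_map B h y")
    case False
    then have pos: "0 < norm (choice_map B h y' - choice_map B h y)" by simp
    have "(K * norm (choice_map B h y' - choice_map B h y)) * norm (choice_map B h y' - choice_map B h y)
      \<le> norm (y' - y) * norm (choice_map B h y' - choice_map B h y)"
      using order_trans[OF est[of y' y] norm_cauchy_schwarz] by (simp add: power2_eq_square)
    then show ?thesis using pos by (rule mult_right_le_imp_le)
  qed simp
  then have "norm (choice_map B h y' - choice_map B h y) \<le> 1/K * norm (y' - y)" for y y'
    using K by (simp add: field_simps)
  then show ?thesis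
    using K by (intro exI[of _ "1/K"] lipschitz_onI) (auto simp: dist_norm)
qed

text \<open>Mixed strategies vanish off \<open>B\<close>, so both objectives agree on
  \<open>mixed B\<close> and the two choices are made from the same set of maximisers.\<close>

lemma choice_map_cong:
  assumes "\<And>\<alpha>. \<alpha> \<in> B \<Longrightarrow> y $ \<alpha> = y' $ \<alpha>"
  shows "choice_map B h y = choice_map B h y'"
proof -
  have "y \<bullet> x = y' \<bullet> x" if "x \<in> mixed B" for x
    unfolding inner_vec_def using assms mixed_eq_0[OF that] by (intro sum.cong) auto
  then have "is_arg_max (\<lambda>x. y \<bullet> x - h x) (\<lambda>x. x \<in> mixed B) = is_arg_max (\<lambda>x. y' \<bullet> x - h x) (\<lambda>x. x \<in> mixed B)"
    by (auto simp: is_arg_max_def fun_eq_iff)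
  then show ?thesis
    by (simp add: choice_map_def arg_max_on_def arg_max_def)
qed

lemma choice_map_extinct:
  fixes y :: "real \<Rightarrow> real^'a::finite"
  assumes pen: "penalty B h" and p: "p \<in> mixed B" "p' \<in> mixed B"
    and lim: "filterlim (\<lambda>t. y t \<bullet> (p' - p)) at_top F"
  shows "((\<lambda>t. Min ((\<lambda>\<alpha>. choice_map B h (y t) $ \<alpha>) ` supp p)) \<longlongrightarrow> 0) F"
proof -
  have B: "B \<noteq> {}" using p mixed_sum[of p B] by auto
  note Q = choice_map_maximizes[OF pen B]
  have fin: "finite ((\<lambda>\<alpha>. choice_map B h (y t) $ \<alpha>) ` supp p)" "(\<lambda>\<alpha>. choice_map B h (y t) $ \<alpha>) ` supp p \<noteq> {}" for t
    using supp_mixed_nonempty[OF p(1)] by auto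
  have "bounded (h ` mixed B)"
    using pen compact_continuous_image[OF _ compact_mixed] compact_imp_bounded by (auto simp: penalty_def)
  then obtain C where C: "\<And>x. x \<in> mixed B \<Longrightarrow> \<bar>h x\<bar> \<le> C"
    by (auto simp: bounded_iff)
  show ?thesis
  proof (rule order_tendstoI)
    fix e :: real assume "e < 0"
    then have "e < Min ((\<lambda>\<alpha>. choice_map B h (y t) $ \<alpha>) ` supp p)" for t
      using mixed_nonneg[OF Q(1), of "y t"] fin[of t] by (subst Min_gr_iff) (auto intro: less_le_trans)
    then show "\<forall>\<^sub>F t in F. e < Min ((\<lambda>\<alpha>. choice_map B h (y t) $ \<alpha>) ` supp p)" by simp
  next
    fix e :: real assume e: "0 < e"
    \<comment> \<open>\<open>2 * C\<close> bounds the oscillation of \<open>h\<close>, and division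
      by \<open>e\<close> undoes the step length; the summand 1 makes the final contradiction
      strict.\<close>
    have "\<forall>\<^sub>F t in F. 2 * C / e + 1 \<le> y t \<bullet> (p' - p)"
      using lim by (simp add: filterlim_at_top)
    then show "\<forall>\<^sub>F t in F. Min ((\<lambda>\<alpha>. choice_map B h (y t) $ \<alpha>) ` supp p) < e"
    proof eventually_elim
      case (elim t)
      show ?case
      proof (rule ccontr)
        assume "\<not> ?thesis"
        then have ge: "e \<le> choice_map B h (y t) $ \<alpha>" if "\<alpha> \<in> supp p" for \<alpha>
          using fin[of t] that by (auto simp: not_less)
        define x where "x = choice_map B h (y t)"
        have x: "x \<in> mixed B" unfolding x_def by (rule Q)
        define z where "z = x + e *\<^sub>R (p' - p)"
        \<comment> \<open>On \<open>supp p\<close> at most \<open>e\<close> is subtracted, which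
          \<open>x\<close> can afford; elsewhere nothing is subtracted.\<close>
        have "0 \<le> z $ \<alpha>" for \<alpha>
        proof (cases "\<alpha> \<in> supp p")
          case True
          have "e * p $ \<alpha> \<le> e * 1"
            using e mixed_le_1[OF p(1), of \<alpha>] by (intro mult_left_mono) auto
          moreover have "0 \<le> e * p' $ \<alpha>"
            using e mixed_nonneg[OF p(2), of \<alpha>] by simp
          ultimately show ?thesis
            using ge[OF True] by (simp add: z_def x_def algebra_simps)
        next
          case False
          then have "p $ \<alpha> = 0" by (simp add: supp_def)
          then show ?thesis
            using e mixed_nonneg[OF p(2), of \<alpha>] mixed_nonneg[OF x, of \<alpha>] by (simp add: z_def)
        qed
        moreover have "(\<Sum>\<alpha>\<in>B. z $ \<alpha>) = 1"
          using mixed_sum[OF x] mixed_sum[OF p(1)] mixed_sum[OF p(2)]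
          by (simp add: z_def sum.distrib sum_distrib_left[symmetric] sum_subtractf)
        moreover have "z $ \<alpha> = 0" if "\<alpha> \<notin> B" for \<alpha>
          using that mixed_eq_0[OF x] mixed_eq_0[OF p(1)] mixed_eq_0[OF p(2)] by (simp add: z_def)
        ultimately have z: "z \<in> mixed B" by (simp add: mixed_def)
        from Q(2)[OF z, of "y t"]
        have "y t \<bullet> x + e * (y t \<bullet> (p' - p)) - h z \<le> y t \<bullet> x - h x"
          by (simp add: z_def x_def inner_add_right)
        then have "e * (y t \<bullet> (p' - p)) \<le> 2 * C"
          using C[OF x] C[OF z] by linarith
        moreover have "e * (2 * C / e + 1) \<le> e * (y t \<bullet> (p' - p))"
          using elim e by (intro mult_left_mono) auto
        ultimately show False using e by (simp add: algebra_simps)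
      qed
    qed
  qed
qed

section \<open>Extinction along a single path\<close>

definition pure_profile :: "('p::finite \<Rightarrow> 'a::finite) \<Rightarrow> real^'a^'p" where
  "pure_profile s = (\<chi> j. axis (s j) 1)"

lemma sum_PiE_split:
  fixes A :: "'p::finite \<Rightarrow> 'a::finite set"
  shows "(\<Sum>s\<in>PiE UNIV A. g s) = (\<Sum>\<beta>\<in>A k. \<Sum>r\<in>PiE (UNIV - {k}) A. g (r(k := \<beta>)))"
proof -
  have "PiE UNIV A = (\<lambda>(\<beta>, r). r(k := \<beta>)) ` (A k \<times> PiE (UNIV - {k}) A)"
    using PiE_insert_eq[of k "UNIV - {k}" A] by (simp add: insert_absorb)
  then have "(\<Sum>s\<in>PiE UNIV A. g s) = (\<Sum>(\<beta>, r)\<in>A k \<times> PiE (UNIV - {k}) A. g (r(k := \<beta>)))"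
    using sum.reindex[OF inj_combinator[of k "UNIV - {k}" A], of g] by (simp add: o_def split_beta)
  then show ?thesis by (simp add: sum.cartesian_product)
qed

text \<open>Row \<open>k\<close> is overwritten by a unit vector, so only
  \<open>\<beta> = \<alpha>\<close> contributes and the own strategy of player \<open>k\<close>
  drops out. What remains is a polynomial in the other rows, which also yields continuity.\<close>

lemma payoff_vec_component:
  fixes A :: "'p::finite \<Rightarrow> 'a::finite set"
  assumes "\<alpha> \<in> A k"
  shows "payoff_vec A u k x $ \<alpha>
    = (\<Sum>r\<in>PiE (UNIV - {k}) A. (\<Prod>j\<in>UNIV - {k}. x $ j $ r j) * u k (r(k := \<alpha>)))"
proof -
  have weight: "(\<Prod>j\<in>UNIV. replace_row x k (axis \<alpha> 1) $ j $ (r(k := \<beta>)) j)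
      = (if \<beta> = \<alpha> then 1 else 0) * (\<Prod>j\<in>UNIV - {k}. x $ j $ r j)" for r \<beta>
    by (subst prod.remove[of _ k]) (auto simp: replace_row_def axis_def intro!: prod.cong)
  have "payoff_vec A u k x $ \<alpha> = (\<Sum>\<beta>\<in>A k. \<Sum>r\<in>PiE (UNIV - {k}) A.
      ((if \<beta> = \<alpha> then 1 else 0) * (\<Prod>j\<in>UNIV - {k}. x $ j $ r j)) * u k (r(k := \<beta>)))"
    using assms by (simp add: payoff_vec_def mult_ext_def sum_PiE_split[where k = k] weight
      del: fun_upd_apply)
  also have "\<dots> = (\<Sum>\<beta>\<in>A k. if \<beta> = \<alpha> then
      \<Sum>r\<in>PiE (UNIV - {k}) A. (\<Prod>j\<in>UNIV - {k}. x $ j $ r j) * u k (r(k := \<beta>)) else 0)"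
    by (intro sum.cong) auto
  also have "\<dots> = (\<Sum>r\<in>PiE (UNIV - {k}) A. (\<Prod>j\<in>UNIV - {k}. x $ j $ r j) * u k (r(k := \<alpha>)))"
    using assms by simp
  finally show ?thesis .
qed

lemma payoff_vec_pure:
  fixes A :: "'p::finite \<Rightarrow> 'a::finite set"
  assumes "\<alpha> \<in> A k" "s \<in> PiE UNIV A"
  shows "payoff_vec A u k (pure_profile s) $ \<alpha> = u k (s(k := \<alpha>))"
proof -
  \<comment> \<open>Elements of \<open>PiE (UNIV - {k}) A\<close> are \<open>undefined\<close> at
    \<open>k\<close>, so \<open>s\<close> has to be restricted to become one; the update at
    \<open>k\<close> overwrites this default.\<close>
  let ?r = "restrict s (UNIV - {k})"
  have r: "?r \<in> PiE (UNIV - {k}) A" using assms by auto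
  have upd: "?r(k := \<alpha>) = s(k := \<alpha>)" by (auto simp: restrict_def)
  have "(\<Prod>j\<in>UNIV - {k}. pure_profile s $ j $ r j) = (if r = ?r then 1 else 0)"
    if "r \<in> PiE (UNIV - {k}) A" for r
  proof (cases "r = ?r")
    case True
    then show ?thesis by (auto simp: pure_profile_def axis_def)
  next
    case False
    have "\<exists>j\<in>UNIV - {k}. r j \<noteq> s j"
    proof (rule ccontr)
      assume "\<not> ?thesis"
      then have "r = ?r" by (intro PiE_ext[OF that r]) auto
      with False show False by simp
    qed
    then obtain j where "j \<in> UNIV - {k}" "r j \<noteq> s j" by auto
    then have "(\<Prod>j\<in>UNIV - {k}. pure_profile s $ j $ r j) = 0"
      by (intro prod_zero) (auto simp: pure_profile_def axis_def)
    then show ?thesis using False by simp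
  qed
  then have "payoff_vec A u k (pure_profile s) $ \<alpha>
      = (\<Sum>r\<in>PiE (UNIV - {k}) A. if r = ?r then u k (r(k := \<alpha>)) else 0)"
    unfolding payoff_vec_component[where A = A, OF assms(1)] by (intro sum.cong) auto
  also have "\<dots> = u k (s(k := \<alpha>))"
    using r upd by (simp add: finite_PiE)
  finally show ?thesis .
qed

text \<open>The payoff of player \<open>k\<close> does not depend on row \<open>k\<close>, but
  summing over full profiles is harmless because the weights in that row add up to 1. The weights
  then form one probability distribution on pure profiles, the same for every player.\<close>

lemma payoff_vec_mixture:
  fixes A :: "'p::finite \<Rightarrow> 'a::finite set"
  assumes x: "x \<in> mixed_profiles A"
  shows "payoff_vec A u k x \<bullet> q
    = (\<Sum>s\<in>PiE UNIV A. (\<Prod>j\<in>UNIV. x $ j $ s j) * (payoff_vec A u k (pure_profile s) \<bullet> q))"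
proof -
  have comp: "payoff_vec A u k x $ \<alpha>
    = (\<Sum>s\<in>PiE UNIV A. (\<Prod>j\<in>UNIV. x $ j $ s j) * payoff_vec A u k (pure_profile s) $ \<alpha>)" for \<alpha>
  proof (cases "\<alpha> \<in> A k")
    case False
    then show ?thesis by (simp add: payoff_vec_def)
  next
    case True
    have "(\<Sum>s\<in>PiE UNIV A. (\<Prod>j\<in>UNIV. x $ j $ s j) * payoff_vec A u k (pure_profile s) $ \<alpha>)
        = (\<Sum>s\<in>PiE UNIV A. (\<Prod>j\<in>UNIV. x $ j $ s j) * u k (s(k := \<alpha>)))"
      by (intro sum.cong refl) (simp add: payoff_vec_pure[where A = A and k = k, OF True])
    also have "\<dots> = (\<Sum>\<beta>\<in>A k. \<Sum>r\<in>PiE (UNIV - {k}) A.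
        x $ k $ \<beta> * ((\<Prod>j\<in>UNIV - {k}. x $ j $ r j) * u k (r(k := \<alpha>))))"
      unfolding sum_PiE_split[where k = k and A = A]
    proof (intro sum.cong refl)
      fix \<beta> r
      have "(\<Prod>j\<in>UNIV. x $ j $ (r(k := \<beta>)) j) = x $ k $ \<beta> * (\<Prod>j\<in>UNIV - {k}. x $ j $ r j)"
        by (subst prod.remove[of _ k]) (auto intro!: prod.cong)
      then show "(\<Prod>j\<in>UNIV. x $ j $ (r(k := \<beta>)) j) * u k (r(k := \<beta>, k := \<alpha>))
        = x $ k $ \<beta> * ((\<Prod>j\<in>UNIV - {k}. x $ j $ r j) * u k (r(k := \<alpha>)))" by simp
    qed
    also have "\<dots> = (\<Sum>\<beta>\<in>A k. x $ k $ \<beta>) *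
        (\<Sum>r\<in>PiE (UNIV - {k}) A. (\<Prod>j\<in>UNIV - {k}. x $ j $ r j) * u k (r(k := \<alpha>)))"
      by (simp add: sum_product)
    also have "(\<Sum>\<beta>\<in>A k. x $ k $ \<beta>) = 1"
      using x by (intro mixed_sum) (simp add: profiles_def)
    finally show ?thesis
      unfolding payoff_vec_component[where A = A and k = k and x = x, OF True] by (simp only: mult_1_left)
  qed
  show ?thesis
    unfolding inner_vec_def comp
    by (simp add: sum_distrib_left sum_distrib_right mult.assoc) (rule sum.swap)
qed

lemma sum_pure_weights:
  fixes A :: "'p::finite \<Rightarrow> 'a::finite set"
  assumes "x \<in> mixed_profiles A"
  shows "(\<Sum>s\<in>PiE UNIV A. \<Prod>j\<in>UNIV. x $ j $ s j) = 1"
proof -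
  have "(\<Sum>s\<in>PiE UNIV A. \<Prod>j\<in>UNIV. x $ j $ s j) = (\<Prod>j\<in>UNIV. \<Sum>\<alpha>\<in>A j. x $ j $ \<alpha>)"
    by (simp add: prod_sum_PiE)
  also have "\<dots> = 1"
    using assms mixed_sum by (intro prod.neutral) (auto simp: profiles_def)
  finally show ?thesis .
qed

lemma continuous_on_payoff_vec:
  "continuous_on S (\<lambda>x. payoff_vec A u k x $ \<alpha>)"
proof (cases "\<alpha> \<in> A k")
  case True
  show ?thesis
    unfolding payoff_vec_component[where A = A and k = k, OF True] by (intro continuous_intros)
qed (simp add: payoff_vec_def)

text \<open>Pure profiles inside \<open>S\<close> are finitely many, so their positive payoffs have
  a positive minimum. Every other pure profile has a vanishing factor in its weight, and their joint
  contribution eventually costs at most half of that minimum.\<close>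

lemma eventually_payoff_pos:
  fixes A :: "'p::finite \<Rightarrow> 'a::finite set" and x :: "real \<Rightarrow> real^'a^'p"
  assumes x: "eventually (\<lambda>t. x t \<in> mixed_profiles A) F"
    and vanish: "\<And>j \<alpha>. \<alpha> \<in> A j \<Longrightarrow> \<alpha> \<notin> S j \<Longrightarrow> ((\<lambda>t. x t $ j $ \<alpha>) \<longlongrightarrow> 0) F"
    and pos: "\<And>s. s \<in> PiE UNIV A \<Longrightarrow> (\<And>j. s j \<in> S j) \<Longrightarrow> 0 < payoff_vec A u k (pure_profile s) \<bullet> q"
  shows "\<exists>m>0. eventually (\<lambda>t. m \<le> payoff_vec A u k (x t) \<bullet> q) F"
proof -
  define d where "d s = payoff_vec A u k (pure_profile s) \<bullet> q" for s
  define w where "w s t = (\<Prod>j\<in>UNIV. x t $ j $ s j)" for s t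
  define P where "P = PiE UNIV A"
  define R where "R = {s \<in> P. \<forall>j. s j \<in> S j}"
  have fin: "finite P" "finite R" by (simp_all add: P_def R_def finite_PiE)
  \<comment> \<open>For empty \<open>R\<close> there is no minimum, and the value 1 is an arbitrary
    choice.\<close>
  have "\<exists>m>0. \<forall>s\<in>R. m \<le> d s"
  proof (cases "R = {}")
    case False
    then show ?thesis
      using fin pos by (intro exI[of _ "Min (d ` R)"]) (auto simp: R_def P_def d_def)
  qed (auto intro: exI[of _ 1])
  then obtain m where m: "0 < m" "\<And>s. s \<in> R \<Longrightarrow> m \<le> d s" by auto
  have w0: "(w s \<longlongrightarrow> 0) F" if s: "s \<in> P - R" for s
  proof -
    obtain j where j: "s j \<notin> S j" using s by (auto simp: R_def)
    have sj: "s j \<in> A j" using s by (auto simp: P_def)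
    show ?thesis
    proof (rule tendsto_sandwich[OF _ _ tendsto_const vanish[OF sj j]])
      show "\<forall>\<^sub>F t in F. 0 \<le> w s t"
        using x by eventually_elim (auto simp: w_def profiles_def intro!: prod_nonneg mixed_nonneg)
      show "\<forall>\<^sub>F t in F. w s t \<le> x t $ j $ s j"
        using x
      proof eventually_elim
        case (elim t)
        then have mx: "x t $ i \<in> mixed (A i)" for i by (simp add: profiles_def)
        have "w s t = x t $ j $ s j * (\<Prod>i\<in>UNIV - {j}. x t $ i $ s i)"
          unfolding w_def by (subst prod.remove[of _ j]) auto
        also have "\<dots> \<le> x t $ j $ s j * 1"
          using mx by (intro mult_left_mono prod_le_1) (auto intro: mixed_nonneg mixed_le_1)
        finally show ?case by simp
      qed
    qed
  qed
  have "((\<lambda>t. \<Sum>s\<in>P - R. w s t * (d s - m)) \<longlongrightarrow> (\<Sum>s\<in>P - R. 0 * (d s - m))) F"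
    by (intro tendsto_intros w0)
  then have "\<forall>\<^sub>F t in F. - (m/2) < (\<Sum>s\<in>P - R. w s t * (d s - m))"
    using m(1) by (intro order_tendstoD(1)) auto
  with x have "\<forall>\<^sub>F t in F. m/2 \<le> payoff_vec A u k (x t) \<bullet> q"
  proof eventually_elim
    case (elim t)
    have "payoff_vec A u k (x t) \<bullet> q - m = (\<Sum>s\<in>P. w s t * d s) - (\<Sum>s\<in>P. w s t) * m"
      using payoff_vec_mixture[OF elim(1), of u k q] sum_pure_weights[OF elim(1)]
      by (simp add: w_def d_def P_def)
    also have "\<dots> = (\<Sum>s\<in>P. w s t * (d s - m))"
      by (simp add: sum_distrib_right sum_subtractf right_diff_distrib)
    also have "\<dots> = (\<Sum>s\<in>P - R. w s t * (d s - m)) + (\<Sum>s\<in>R. w s t * (d s - m))"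
      using fin by (intro sum.subset_diff) (auto simp: R_def)
    also have "\<dots> \<ge> - (m/2) + 0"
    proof (intro add_mono sum_nonneg mult_nonneg_nonneg)
      show "0 \<le> w s t" for s
        using elim(1) by (auto simp: w_def profiles_def intro!: prod_nonneg mixed_nonneg)
    qed (use elim(2) m(2) in auto)
    finally show ?case by simp
  qed
  then show ?thesis using m(1) by (intro exI[of _ "m/2"]) auto
qed

section \<open>Linear growth of score differences\<close>

lemma linear_growth:
  fixes g n z :: "real \<Rightarrow> real"
  assumes int: "\<And>t. 0 \<le> t \<Longrightarrow> g integrable_on {0..t}"
    and lower: "eventually (\<lambda>t. m \<le> g t) at_top" and m: "0 < m"
    and z: "\<And>t. 0 \<le> t \<Longrightarrow> z t = integral {0..t} g + n t"
    and n: "((\<lambda>t. n t / t) \<longlongrightarrow> 0) at_top"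
  shows "eventually (\<lambda>t. m / 2 * t \<le> z t) at_top"
proof -
  obtain t0 where t0: "0 \<le> t0" "\<And>t. t0 \<le> t \<Longrightarrow> m \<le> g t"
    using lower unfolding eventually_at_top_linorder by (metis max.bounded_iff max.cobounded1 max.cobounded2)
  \<comment> \<open>\<open>c\<close> collects the payoff before \<open>t0\<close> and corrects for
    counting \<open>m\<close> from time 0, so that \<open>c + m * t\<close> bounds the integral from
    below. It is constant, so half of the slope \<open>m\<close> absorbs both it and the
    noise.\<close>
  define c where "c = integral {0..t0} g - m * t0"
  have "((\<lambda>t. c / t + n t / t) \<longlongrightarrow> 0 + 0) at_top"
    by (intro tendsto_add n tendsto_divide_0[OF tendsto_const] filterlim_at_top_imp_at_infinity filterlim_ident)
  then have "eventually (\<lambda>t. - (m/2) < c / t + n t / t) at_top"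
    using m by (intro order_tendstoD(1)) auto
  moreover have "eventually (\<lambda>t. max 1 t0 \<le> t) at_top"
    by (rule eventually_ge_at_top)
  ultimately show ?thesis
  proof eventually_elim
    case (elim t)
    then have t: "t0 \<le> t" "0 < t" "0 \<le> t" by auto
    have split: "integral {0..t} g = integral {0..t0} g + integral {t0..t} g"
      using Henstock_Kurzweil_Integration.integral_combine[OF t0(1) t(1) int[OF t(3)]] by simp
    have "g integrable_on {t0..t}"
      by (rule integrable_subinterval_real[OF int[OF t(3)]]) (use t0 in auto)
    then have "integral {t0..t} (\<lambda>_. m) \<le> integral {t0..t} g"
      by (intro integral_le integrable_const_ivl) (use t0 in auto)
    then have "c + m * t \<le> integral {0..t} g"
      using t split by (simp add: c_def algebra_simps)
    moreover have "- (m/2) * t \<le> (c / t + n t / t) * t"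
      using elim(1) t by (intro mult_right_mono) auto
    ultimately show ?case
      using z[OF t(3)] t by (simp add: algebra_simps)
  qed
qed

section \<open>Deterministic score paths and the elimination rounds\<close>

lemma learning_parameter_continuous:
  assumes "learning_parameter \<eta>"
  shows "continuous_on {0..} \<eta>"
proof -
  obtain \<eta>' where "\<And>t. 0 \<le> t \<Longrightarrow> (\<eta> has_real_derivative \<eta>' t) (at t within {0..})"
    using assms by (auto simp: learning_parameter_def)
  then show ?thesis by (intro DERIV_continuous_on) auto
qed

lemma surviving_subset: "surviving A u r k \<subseteq> mixed (A k)"
  by (induction r) auto

lemma dominated_imp_iteratively_dominated:
  "p \<in> mixed (A k) \<Longrightarrow> dominated A u k p \<Longrightarrow> iteratively_dominated A u k p"
  unfolding iteratively_dominated_def dominated_def by (intro exI[of _ "Suc 0"]) auto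

text \<open>The residual of the score equation. Along a solution it equals the Ito integral almost
  surely at each fixed time, but being defined from the path it is a function of all
  \<open>t\<close> simultaneously and inherits continuity.\<close>

definition noise :: "('p::finite \<Rightarrow> 'a::finite set) \<Rightarrow> ('p \<Rightarrow> ('p \<Rightarrow> 'a) \<Rightarrow> real)
    \<Rightarrow> (real \<Rightarrow> real^'a^'p) \<Rightarrow> (real \<Rightarrow> real^'a^'p) \<Rightarrow> 'p \<Rightarrow> 'a \<Rightarrow> real \<Rightarrow> real" where
  "noise A u y x j \<alpha> t =
    y t $ j $ \<alpha> - y 0 $ j $ \<alpha> - integral {0..t} (\<lambda>s. payoff_vec A u j (x s) $ \<alpha>)"

text \<open>One realisation, with the probability removed. The score equation is not among the
  assumptions: it is encoded in \<open>noise\<close>, whose sublinear growth is a hypothesis of the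
  lemmas on extinction.\<close>

locale srl_path =
  fixes A :: "'p::finite \<Rightarrow> 'a::finite set" and u :: "'p \<Rightarrow> ('p \<Rightarrow> 'a) \<Rightarrow> real"
    and h :: "'p \<Rightarrow> real^'a \<Rightarrow> real" and \<eta> :: "'p \<Rightarrow> real \<Rightarrow> real"
    and y x :: "real \<Rightarrow> real^'a^'p"
  assumes actions: "\<And>j. A j \<noteq> {}"
    and penalty: "\<And>j. penalty (A j) (h j)"
    and learning: "\<And>j. learning_parameter (\<eta> j)"
    and x: "\<And>t j. 0 \<le> t \<Longrightarrow> x t $ j = choice_map (A j) (h j) (\<eta> j t *\<^sub>R y t $ j)"
    and y_cont: "\<And>j \<alpha>. \<alpha> \<in> A j \<Longrightarrow> continuous_on {0..} (\<lambda>t. y t $ j $ \<alpha>)"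
begin

lemma x_mixed: "0 \<le> t \<Longrightarrow> x t \<in> mixed_profiles A"
  using choice_map_maximizes(1)[OF penalty actions] by (simp add: profiles_def x)

lemma x_continuous: "continuous_on {0..} x"
proof -
  have "continuous_on {0..} (\<lambda>t. x t $ j)" for j
  proof -
    obtain L where "L-lipschitz_on UNIV (choice_map (A j) (h j))"
      using choice_map_lipschitz[OF penalty actions] by blast
    then have Q: "continuous_on UNIV (choice_map (A j) (h j))"
      by (rule lipschitz_on_continuous_on)
    \<comment> \<open>Scores off \<open>A j\<close> are unconstrained and may be discontinuous;
      setting them to 0 does not change the choice.\<close>
    define y' where "y' t = (\<chi> \<alpha>. if \<alpha> \<in> A j then y t $ j $ \<alpha> else 0)" for t
    have "continuous_on {0..} y'"
      unfolding y'_def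
    proof (rule continuous_on_vec_lambda)
      show "continuous_on {0..} (\<lambda>t. if \<alpha> \<in> A j then y t $ j $ \<alpha> else 0)" for \<alpha>
        using y_cont by (cases "\<alpha> \<in> A j") auto
    qed
    then have "continuous_on {0..} (\<lambda>t. choice_map (A j) (h j) (\<eta> j t *\<^sub>R y' t))"
      using learning_parameter_continuous[OF learning]
      by (intro continuous_on_compose2[OF Q] continuous_intros) auto
    then show ?thesis
    proof (rule continuous_on_eq)
      fix t :: real assume "t \<in> {0..}"
      then show "choice_map (A j) (h j) (\<eta> j t *\<^sub>R y' t) = x t $ j"
        by (subst x) (auto simp: y'_def intro: choice_map_cong)
    qed
  qed
  then have "continuous_on {0..} (\<lambda>t. \<chi> j. x t $ j)" by (rule continuous_on_vec_lambda)
  then show ?thesis by simp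
qed

lemma payoff_continuous: "continuous_on {0..} (\<lambda>t. payoff_vec A u j (x t) $ \<alpha>)"
  by (rule continuous_on_compose2[OF continuous_on_payoff_vec[of UNIV] x_continuous]) auto

lemma payoff_integrable: "(\<lambda>s. payoff_vec A u j (x s) $ \<alpha>) integrable_on {0..t}"
  by (intro integrable_continuous_real continuous_on_subset[OF payoff_continuous]) auto

lemma noise_continuous:
  assumes "\<alpha> \<in> A j"
  shows "continuous_on {0..T} (noise A u y x j \<alpha>)"
  unfolding noise_def
  by (intro continuous_intros indefinite_integral_continuous_1 payoff_integrable
    continuous_on_subset[OF y_cont[OF assms]]) auto

lemma extinct_of_eventual_advantage:
  assumes p: "p \<in> mixed (A k)" "p' \<in> mixed (A k)"
    and noise: "\<And>\<alpha>. \<alpha> \<in> A k \<Longrightarrow> ((\<lambda>t. noise A u y x k \<alpha> t / t) \<longlongrightarrow> 0) at_top"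
    and m: "0 < m" "eventually (\<lambda>t. m \<le> payoff_vec A u k (x t) \<bullet> (p' - p)) at_top"
  shows "extinct_along p k x"
proof -
  define q where "q = p' - p"
  \<comment> \<open>Hence the scores off \<open>A k\<close>, about which nothing is known, do not
    enter the inner product with \<open>q\<close>.\<close>
  have q0: "q $ \<alpha> = 0" if "\<alpha> \<notin> A k" for \<alpha>
    using that mixed_eq_0[OF p(1)] mixed_eq_0[OF p(2)] by (simp add: q_def)
  have inner_q: "v \<bullet> q = (\<Sum>\<alpha>\<in>A k. q $ \<alpha> * v $ \<alpha>)" for v
    unfolding inner_vec_def by (rule sum.mono_neutral_cong_right) (auto simp: q0)
  \<comment> \<open>The initial score is counted with the noise: it is constant in \<open>t\<close>,
    so sublinear as well.\<close>
  define n where "n t = (\<Sum>\<alpha>\<in>A k. q $ \<alpha> * (y 0 $ k $ \<alpha> + noise A u y x k \<alpha> t))" for t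
  have "((\<lambda>t. \<Sum>\<alpha>\<in>A k. q $ \<alpha> * (y 0 $ k $ \<alpha> / t + noise A u y x k \<alpha> t / t)) \<longlongrightarrow> (\<Sum>\<alpha>\<in>A k. q $ \<alpha> * (0 + 0))) at_top"
    by (intro tendsto_sum tendsto_mult tendsto_const tendsto_add noise
      tendsto_divide_0[OF tendsto_const] filterlim_at_top_imp_at_infinity filterlim_ident) auto
  then have n: "((\<lambda>t. n t / t) \<longlongrightarrow> 0) at_top"
    by (simp add: n_def sum_divide_distrib flip: add_divide_distrib)
  have growth: "eventually (\<lambda>t. m / 2 * t \<le> y t $ k \<bullet> q) at_top"
  proof (rule linear_growth[OF _ m(2)[folded q_def] m(1) _ n])
    show "(\<lambda>t. payoff_vec A u k (x t) \<bullet> q) integrable_on {0..t}" for t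
      unfolding inner_q by (intro integrable_sum integrable_on_mult_right payoff_integrable) auto
    show "y t $ k \<bullet> q = integral {0..t} (\<lambda>t. payoff_vec A u k (x t) \<bullet> q) + n t" for t
    proof -
      have "integral {0..t} (\<lambda>t. payoff_vec A u k (x t) \<bullet> q)
        = (\<Sum>\<alpha>\<in>A k. q $ \<alpha> * integral {0..t} (\<lambda>s. payoff_vec A u k (x s) $ \<alpha>))"
        unfolding inner_q
        by (subst integral_sum) (auto intro!: integrable_on_mult_right payoff_integrable)
      then show ?thesis
        unfolding inner_q n_def noise_def sum.distrib[symmetric]
        by (simp add: sum.distrib[symmetric] algebra_simps)
    qed
  qed
  have lim: "filterlim (\<lambda>t. t * \<eta> k t) at_top at_top" and \<eta>: "\<And>t. 0 \<le> t \<Longrightarrow> 0 < \<eta> k t"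
    using learning[of k] by (auto simp: learning_parameter_def)
  have "filterlim (\<lambda>t. m / 2 * (t * \<eta> k t)) at_top at_top"
    using m(1) by (intro filterlim_tendsto_pos_mult_at_top[OF tendsto_const _ lim]) auto
  moreover have "eventually (\<lambda>t. m / 2 * (t * \<eta> k t) \<le> (\<eta> k t *\<^sub>R y t $ k) \<bullet> (p' - p)) at_top"
    using growth eventually_ge_at_top[of 0]
  proof eventually_elim
    case (elim t)
    then show ?case
      using mult_left_mono[OF elim(1), of "\<eta> k t"] \<eta>[of t] by (simp add: q_def ac_simps)
  qed
  ultimately have "filterlim (\<lambda>t. (\<eta> k t *\<^sub>R y t $ k) \<bullet> (p' - p)) at_top at_top"
    by (rule filterlim_at_top_mono)
  from choice_map_extinct[OF penalty p this]
  have "((\<lambda>t. Min ((\<lambda>\<alpha>. choice_map (A k) (h k) (\<eta> k t *\<^sub>R y t $ k) $ \<alpha>) ` supp p)) \<longlongrightarrow> 0) at_top" .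
  moreover have "\<forall>\<^sub>F t in at_top. Min ((\<lambda>\<alpha>. choice_map (A k) (h k) (\<eta> k t *\<^sub>R y t $ k) $ \<alpha>) ` supp p)
      = Min ((\<lambda>\<alpha>. x t $ k $ \<alpha>) ` supp p)"
    using eventually_ge_at_top[of 0] by eventually_elim (simp add: x)
  ultimately show ?thesis
    unfolding extinct_along_def by (rule Lim_transform_eventually)
qed

text \<open>A pure strategy has a single action as its support, so its extinction says that this
  coordinate tends to 0. The induction runs over all players and strategies together, because an
  advantage of player \<open>k\<close> in a given round rests on the eliminated actions of every
  player.\<close>

lemma iteratively_dominated_extinct:
  assumes noise: "\<And>j \<alpha>. \<alpha> \<in> A j \<Longrightarrow> ((\<lambda>t. noise A u y x j \<alpha> t / t) \<longlongrightarrow> 0) at_top"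
    and p: "p \<in> mixed (A k)" "iteratively_dominated A u k p"
  shows "extinct_along p k x"
proof -
  have "p \<in> mixed (A k) \<Longrightarrow> p \<notin> surviving A u r k \<Longrightarrow> extinct_along p k x" for r k p
  proof (induction r arbitrary: k p)
    case (Suc r)
    show ?case
    proof (cases "p \<in> surviving A u r k")
      \<comment> \<open>\<open>p\<close> is removed exactly in this round, so its dominator survives
        the earlier ones; dominance then applies at every pure profile built from surviving
        actions.\<close>
      case True
      then obtain p' where p': "p' \<in> surviving A u r k"
        and dom: "dominates_on A u (profiles (surviving A u r)) k p' p"
        using Suc.prems by auto
      define S where "S j = {\<alpha> \<in> A j. axis \<alpha> 1 \<in> surviving A u r j}" for j
      have "\<exists>m>0. eventually (\<lambda>t. m \<le> payoff_vec A u k (x t) \<bullet> (p' - p)) at_top"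
      proof (rule eventually_payoff_pos)
        show "\<forall>\<^sub>F t in at_top. x t \<in> mixed_profiles A"
          using eventually_ge_at_top[of 0] by eventually_elim (rule x_mixed)
        show "((\<lambda>t. x t $ j $ \<alpha>) \<longlongrightarrow> 0) at_top" if "\<alpha> \<in> A j" "\<alpha> \<notin> S j" for j \<alpha>
          using Suc.IH[of "axis \<alpha> 1" j] that axis_mixed[of \<alpha> "A j"]
          by (simp add: S_def extinct_along_def supp_axis)
        show "0 < payoff_vec A u k (pure_profile s) \<bullet> (p' - p)" if "\<And>j. s j \<in> S j" for s
        proof -
          have "pure_profile s \<in> profiles (surviving A u r)"
            using that by (simp add: pure_profile_def profiles_def S_def)
          then show ?thesis
            using dom by (simp add: dominates_on_def inner_diff_right)
        qed
      qed
      then obtain m where "0 < m" "eventually (\<lambda>t. m \<le> payoff_vec A u k (x t) \<bullet> (p' - p)) at_top" by auto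
      with Suc.prems(1) subsetD[OF surviving_subset p'] noise show ?thesis
        by (intro extinct_of_eventual_advantage) auto
    qed (use Suc in auto)
  qed simp
  then show ?thesis
    using p by (auto simp: iteratively_dominated_def)
qed

end

theorem theorem4p1:
  fixes A :: "'p::finite \<Rightarrow> 'a::finite set"
    and u :: "'p \<Rightarrow> ('p \<Rightarrow> 'a) \<Rightarrow> real"
    and \<sigma> :: "'p \<Rightarrow> 'a \<Rightarrow> real^'a^'p \<Rightarrow> real"
    and h :: "'p \<Rightarrow> real^'a \<Rightarrow> real"
    and \<eta> :: "'p \<Rightarrow> real \<Rightarrow> real"
    and M :: "'w measure"
    and F :: "real \<Rightarrow> 'w measure"
    and W :: "'p \<times> 'a \<Rightarrow> real \<Rightarrow> 'w \<Rightarrow> real"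
    and Y X :: "real \<Rightarrow> 'w \<Rightarrow> real^'a^'p"
    and k :: 'p
    and p :: "real^'a"
  assumes actions: "\<And>j. A j \<noteq> {}"
    and lipschitz: "\<And>j \<alpha>. \<alpha> \<in> A j \<Longrightarrow> \<exists>L. L-lipschitz_on (mixed_profiles A) (\<sigma> j \<alpha>)"
    and penalty: "\<And>j. penalty (A j) (h j)"
    and learning: "\<And>j. learning_parameter (\<eta> j)"
    and space: "filtered_prob_space M F"
    and wiener: "\<And>j \<alpha>. \<alpha> \<in> A j \<Longrightarrow> wiener_process M F (W (j, \<alpha>))"
    and indep: "independent_processes M W (SIGMA j:UNIV. A j)"
    and solution: "srl_solution M F W A u \<sigma> h \<eta> Y X"
    and p: "p \<in> mixed (A k)"
    and dom: "dominated A u k p \<or> iteratively_dominated A u k p"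
  shows "AE \<omega> in M. extinct_along p k (\<lambda>t. X t \<omega>)"
proof -
  note sol = solution[unfolded srl_solution_def]
  have X: "X t \<omega> $ j = choice_map (A j) (h j) (\<eta> j t *\<^sub>R (Y t \<omega> $ j))"
    if "0 \<le> t" "\<omega> \<in> space M" for t \<omega> j
    using sol that by blast
  have Y_cont: "AE \<omega> in M. \<forall>j\<in>UNIV. \<forall>\<alpha>\<in>A j. continuous_on {0..} (\<lambda>t. Y t \<omega> $ j $ \<alpha>)"
    by (intro AE_finite_allI finite) (use sol in auto)
  have path: "AE \<omega> in M. srl_path A h \<eta> (\<lambda>t. Y t \<omega>) (\<lambda>t. X t \<omega>)"
    using Y_cont AE_space
  proof eventually_elim
    case (elim \<omega>)
    show ?case
      by unfold_locales (use actions penalty learning X elim in auto)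
  qed
  have noise: "AE \<omega> in M. ((\<lambda>t. noise A u (\<lambda>t. Y t \<omega>) (\<lambda>t. X t \<omega>) j \<alpha> t / t) \<longlongrightarrow> 0) at_top"
    if \<alpha>: "\<alpha> \<in> A j" for j \<alpha>
  proof -
    interpret wiener_space M F "W (j, \<alpha>)"
      using space wiener[OF \<alpha>]
      by (auto simp: wiener_space_def wiener_space_axioms_def filtered_prob_space_def)
    obtain L where "L-lipschitz_on (mixed_profiles A) (\<sigma> j \<alpha>)"
      using lipschitz[OF \<alpha>] by blast
    \<comment> \<open>Lipschitz continuity on a compact set gives the uniform bound on the integrand
      that the moment estimates require.\<close>
    then have "bounded (\<sigma> j \<alpha> ` mixed_profiles A)"
      by (intro compact_imp_bounded compact_continuous_image lipschitz_on_continuous_on compact_mixed_profiles)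
    then obtain C where C: "\<And>x. x \<in> mixed_profiles A \<Longrightarrow> \<bar>\<sigma> j \<alpha> x\<bar> \<le> C"
      by (auto simp: bounded_iff)
    show ?thesis
    proof (rule ito_integral_sublinear[where f = "\<lambda>s \<omega>. \<sigma> j \<alpha> (X s \<omega>)"])
      show "\<bar>\<sigma> j \<alpha> (X s \<omega>)\<bar> \<le> C" if "0 \<le> s" "\<omega> \<in> space M" for s \<omega>
        by (rule C) (use that choice_map_maximizes(1)[OF penalty actions] in \<open>simp add: profiles_def X\<close>)
      show "AE \<omega> in M. \<forall>T. continuous_on {0..T} (noise A u (\<lambda>t. Y t \<omega>) (\<lambda>t. X t \<omega>) j \<alpha>)"
        using path by eventually_elim (intro allI srl_path.noise_continuous \<alpha>)
      show "\<exists>J. has_ito_integral M F (W (j, \<alpha>)) (\<lambda>s \<omega>. \<sigma> j \<alpha> (X s \<omega>)) t J \<and>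
          (AE \<omega> in M. noise A u (\<lambda>t. Y t \<omega>) (\<lambda>t. X t \<omega>) j \<alpha> t = J \<omega>)" if t: "0 \<le> t" for t
      proof -
        obtain J where J: "has_ito_integral M F (W (j, \<alpha>)) (\<lambda>s \<omega>. \<sigma> j \<alpha> (X s \<omega>)) t J"
          and eq: "AE \<omega> in M. Y t \<omega> $ j $ \<alpha> = Y 0 \<omega> $ j $ \<alpha>
            + integral {0..t} (\<lambda>s. payoff_vec A u j (X s \<omega>) $ \<alpha>) + J \<omega>"
          using sol \<alpha> t by blast
        from eq have "AE \<omega> in M. noise A u (\<lambda>t. Y t \<omega>) (\<lambda>t. X t \<omega>) j \<alpha> t = J \<omega>"
          by eventually_elim (simp add: noise_def)
        with J show ?thesis by blast
      qed
    qed
  qed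
  have idom: "iteratively_dominated A u k p"
    using dom dominated_imp_iteratively_dominated[where A = A and k = k, OF p] by blast
  have "AE \<omega> in M. \<forall>j\<in>UNIV. \<forall>\<alpha>\<in>A j.
      ((\<lambda>t. noise A u (\<lambda>t. Y t \<omega>) (\<lambda>t. X t \<omega>) j \<alpha> t / t) \<longlongrightarrow> 0) at_top"
    by (intro AE_finite_allI finite noise)
  with path show ?thesis
  proof eventually_elim
    case (elim \<omega>)
    show ?case
      by (rule srl_path.iteratively_dominated_extinct[where u = u and p = p and k = k, OF elim(1) _ p idom])
        (use elim(2) in blast)
  qed
qed

end
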